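(* Let $n\ge2$, $(\epsilon_1,\ldots,\epsilon_n)=(1,\ldots,1,0)$ and $l,m\in\mathbb Z_{\ge0}$. The $\mathcal U_A(1,\ldots,1,0)$-module $\mathcal W_l\otimes\mathcal W_m$ (with action $(\pi_x\otimes\pi_y)\Delta$) is irreducible.
   Context: $q^{1/2},x,y$ are generic (algebraically independent indeterminates over $\mathbb C$), vector spaces are over $\mathbb C(q^{1/2},x,y)$; $[m]=\frac{q^m-q^{-m}}{q-q^{-1}}$. $F$ has basis $|m\rangle$, $m\in\mathbb Z_{\ge0}$; $V$ has basis $|0\rangle,|1\rangle$; $\mathcal W=V^{\otimes(n-1)}\otimes F$ has basis $|\mathbf m\rangle=|m_1,\ldots,m_n\rangle$ ($m_1,\ldots,m_{n-1}\in\{0,1\}$, $m_n\in\mathbb Z_{\ge0}$); $\mathcal W_l$ is the span of $|\mathbf m\rangle$ with $m_1+\cdots+m_n=l$. $\mathbf e_i$ is the $i$th standard basis vector of $\mathbb Z^n$. $\mathcal U_A(\epsilon_1,\ldots,\epsilon_n)$: put $q_i=q$ if $\epsilon_i=0$ and $q_i=-q^{-1}$ if $\epsilon_i=1$; indices are in $\mathbb Z/n\mathbb Z$; $D_{i,j}=\prod_{k\in\{i,i+1\}\cap\{j,j+1\}}q_k^{2\delta_{i,j}-1}$. Generators $e_i,f_i,k_i^{\pm1}$ ($0\le i\le n-1$), relations $k_ik_i^{-1}=k_i^{-1}k_i=1$, $[k_i,k_j]=0$, $k_ie_j=D_{i,j}e_jk_i$, $k_if_j=D_{i,j}^{-1}f_jk_i$,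 $[e_i,f_j]=\delta_{i,j}\frac{k_i-k_i^{-1}}{q-q^{-1}}$; coproduct $\Delta k_i^{\pm1}=k_i^{\pm1}\otimes k_i^{\pm1}$, $\Delta e_i=1\otimes e_i+e_i\otimes k_i$, $\Delta f_i=f_i\otimes1+k_i^{-1}\otimes f_i$. Representation $\pi_x$ on $\mathcal W_l$ (vectors with indices out of range are zero): $e_i|\mathbf m\rangle=x^{\delta_{i,0}}[m_i]|\mathbf m-\mathbf e_i+\mathbf e_{i+1}\rangle$, $f_i|\mathbf m\rangle=x^{-\delta_{i,0}}[m_{i+1}]|\mathbf m+\mathbf e_i-\mathbf e_{i+1}\rangle$, $k_i|\mathbf m\rangle=q_i^{-m_i}q_{i+1}^{m_{i+1}}|\mathbf m\rangle$. *)

theory Defs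
  imports
    "HOL-Computational_Algebra.Polynomial"
    "HOL-Computational_Algebra.Fraction_Field"
    "HOL-Library.Poly_Mapping"
    "HOL-Library.Product_Plus"
    "HOL-Algebra.QuotRing"
begin

section \<open>The ground field\<close>

text \<open>The field of rational functions over the complex numbers in three algebraically independent
  indeterminates: a square root of \<open>q\<close> (innermost polynomial variable), \<open>x\<close> and \<open>y\<close> (outermost).\<close>

type_synonym kfield = "complex poly poly poly fract"

definition q_half :: kfield where "q_half = Fract [:[:[:0, 1:]:]:] 1"
definition x_par :: kfield where "x_par = Fract [:[:0, 1:]:] 1"
definition y_par :: kfield where "y_par = Fract [:0, 1:] 1"

definition q_par :: kfield where "q_par = q_half ^ 2"

definition qnum :: "int \<Rightarrow> kfield" where
  "qnum m = (q_par powi m - q_par powi (- m)) / (q_par - inverse q_par)"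


section \<open>Vector spaces with a given basis\<close>

text \<open>The vector space with basis \<open>'a\<close> is the type \<open>'a \<Rightarrow>\<^sub>0 kfield\<close>; the basis vector attached to
  \<open>a\<close> is \<open>Poly_Mapping.single a 1\<close>.\<close>

definition smul :: "'k::field \<Rightarrow> ('a \<Rightarrow>\<^sub>0 'k) \<Rightarrow> ('a \<Rightarrow>\<^sub>0 'k)"  (infixr \<open>*\<^sub>K\<close> 75) where
  "c *\<^sub>K v = Poly_Mapping.map ((*) c) v"

lemma lookup_smul: "Poly_Mapping.lookup (c *\<^sub>K v) a = c * Poly_Mapping.lookup v a"
  by (simp add: smul_def Poly_Mapping.map.rep_eq when_def)

interpretation pm: vector_space "smul :: 'k::field \<Rightarrow> ('a \<Rightarrow>\<^sub>0 'k) \<Rightarrow> ('a \<Rightarrow>\<^sub>0 'k)"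
  by unfold_locales
    (auto intro!: poly_mapping_eqI simp: lookup_smul lookup_add algebra_simps)

text \<open>Linear extension of a map given on the basis.\<close>

definition lin_ext :: "('a \<Rightarrow> ('b \<Rightarrow>\<^sub>0 'k)) \<Rightarrow> ('a \<Rightarrow>\<^sub>0 'k::field) \<Rightarrow> ('b \<Rightarrow>\<^sub>0 'k)" where
  "lin_ext f v = (\<Sum>a\<in>Poly_Mapping.keys v. Poly_Mapping.lookup v a *\<^sub>K f a)"

text \<open>The tensor product of the spaces with bases \<open>'a\<close> and \<open>'b\<close> is the space with basis
  \<open>'a \<times> 'b\<close>.\<close>

definition tens :: "('a \<Rightarrow>\<^sub>0 'k::field) \<Rightarrow> ('b \<Rightarrow>\<^sub>0 'k) \<Rightarrow> ('a \<times> 'b \<Rightarrow>\<^sub>0 'k)" where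
  "tens u v = (\<Sum>a\<in>Poly_Mapping.keys u. \<Sum>b\<in>Poly_Mapping.keys v.
     Poly_Mapping.single (a, b) (Poly_Mapping.lookup u a * Poly_Mapping.lookup v b))"


section \<open>The algebra \<open>U\<^sub>A(\<epsilon>\<^sub>1,\<dots>,\<epsilon>\<^sub>n)\<close>\<close>

text \<open>Words form a monoid under concatenation, so that the convolution product of
  \<^theory>\<open>HOL-Library.Poly_Mapping\<close> makes \<open>'g list \<Rightarrow>\<^sub>0 kfield\<close> the free unital associative
  algebra on \<open>'g\<close>, and makes \<open>'g list \<times> 'g list \<Rightarrow>\<^sub>0 kfield\<close> its tensor square, with product
  \<open>(a \<otimes> b)(c \<otimes> d) = ac \<otimes> bd\<close>.\<close>

instantiation list :: (type) monoid_add
begin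
definition zero_list :: "'a list" where "zero_list = []"
definition plus_list :: "'a list \<Rightarrow> 'a list \<Rightarrow> 'a list" where "plus_list = (@)"
instance by standard (simp_all add: zero_list_def plus_list_def)
end

text \<open>\<open>Ki i\<close> is the generator written \<open>k\<^sub>i\<^sup>-\<^sup>1\<close>.\<close>

datatype gen = E nat | F nat | K nat | Ki nat

fun gen_index :: "gen \<Rightarrow> nat" where
  "gen_index (E i) = i" | "gen_index (F i) = i" | "gen_index (K i) = i" | "gen_index (Ki i) = i"

type_synonym falg = "gen list \<Rightarrow>\<^sub>0 kfield"

definition gn :: "gen \<Rightarrow> falg" where "gn g = Poly_Mapping.single [g] 1"

definition free_algebra :: "nat \<Rightarrow> falg ring" where
  "free_algebra n =
     \<lparr> carrier = {a. \<forall>w\<in>Poly_Mapping.keys a. \<forall>g\<in>set w. gen_index g < n},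
       monoid.mult = (*), one = 1, zero = 0, add = (+) \<rparr>"

text \<open>Generators are indexed by the representatives \<open>0,\<dots>,n-1\<close> of the integers modulo \<open>n\<close>, whereas
  \<open>\<epsilon>\<^sub>i\<close>, \<open>q\<^sub>i\<close> and \<open>m\<^sub>i\<close> are indexed by \<open>1,\<dots>,n\<close>; \<open>cyc n i\<close> is the representative of \<open>i\<close> among the
  latter.\<close>

definition cyc :: "nat \<Rightarrow> nat \<Rightarrow> nat" where
  "cyc n i = (if i mod n = 0 then n else i mod n)"

definition q_ind :: "(nat \<Rightarrow> nat) \<Rightarrow> nat \<Rightarrow> kfield" where
  "q_ind \<epsilon> i = (if \<epsilon> i = 0 then q_par else - inverse q_par)"

definition D_coef :: "nat \<Rightarrow> (nat \<Rightarrow> nat) \<Rightarrow> nat \<Rightarrow> nat \<Rightarrow> kfield" where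
  "D_coef n \<epsilon> i j =
     (\<Prod>k\<in>{cyc n i, cyc n (i + 1)} \<inter> {cyc n j, cyc n (j + 1)}.
        q_ind \<epsilon> k powi (2 * of_bool (i = j) - 1))"

text \<open>Left-hand side minus right-hand side of each defining relation.\<close>

definition UA_relations :: "nat \<Rightarrow> (nat \<Rightarrow> nat) \<Rightarrow> falg set" where
  "UA_relations n \<epsilon> = (\<Union>i<n. \<Union>j<n.
     { gn (K i) * gn (Ki i) - 1,
       gn (Ki i) * gn (K i) - 1,
       gn (K i) * gn (K j) - gn (K j) * gn (K i),
       gn (K i) * gn (E j) - D_coef n \<epsilon> i j *\<^sub>K (gn (E j) * gn (K i)),
       gn (K i) * gn (F j) - inverse (D_coef n \<epsilon> i j) *\<^sub>K (gn (F j) * gn (K i)),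
       (gn (E i) * gn (F j) - gn (F j) * gn (E i))
         - (of_bool (i = j) / (q_par - inverse q_par)) *\<^sub>K (gn (K i) - gn (Ki i)) })"

definition UA_ideal :: "nat \<Rightarrow> (nat \<Rightarrow> nat) \<Rightarrow> falg set" where
  "UA_ideal n \<epsilon> = genideal (free_algebra n) (UA_relations n \<epsilon>)"

definition UA :: "nat \<Rightarrow> (nat \<Rightarrow> nat) \<Rightarrow> falg set ring" where
  "UA n \<epsilon> = FactRing (free_algebra n) (UA_ideal n \<epsilon>)"

text \<open>The structure map from the ground field to the algebra.\<close>

definition UA_scalar :: "nat \<Rightarrow> (nat \<Rightarrow> nat) \<Rightarrow> kfield \<Rightarrow> falg set" where
  "UA_scalar n \<epsilon> c = a_r_coset (free_algebra n) (UA_ideal n \<epsilon>) (c *\<^sub>K 1)"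


section \<open>Modules\<close>

definition UA_module ::
  "nat \<Rightarrow> (nat \<Rightarrow> nat) \<Rightarrow> ('a \<Rightarrow>\<^sub>0 kfield) set \<Rightarrow>
     (falg set \<Rightarrow> ('a \<Rightarrow>\<^sub>0 kfield) \<Rightarrow> ('a \<Rightarrow>\<^sub>0 kfield)) \<Rightarrow> bool" where
  "UA_module n \<epsilon> M act \<longleftrightarrow>
     pm.subspace M \<and>
     (\<forall>u\<in>carrier (UA n \<epsilon>). \<forall>v\<in>M. act u v \<in> M) \<and>
     (\<forall>u\<in>carrier (UA n \<epsilon>). \<forall>v\<in>M. \<forall>w\<in>M. act u (v + w) = act u v + act u w) \<and>
     (\<forall>u\<in>carrier (UA n \<epsilon>). \<forall>u'\<in>carrier (UA n \<epsilon>). \<forall>v\<in>M.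
        act (u \<oplus>\<^bsub>UA n \<epsilon>\<^esub> u') v = act u v + act u' v) \<and>
     (\<forall>u\<in>carrier (UA n \<epsilon>). \<forall>u'\<in>carrier (UA n \<epsilon>). \<forall>v\<in>M.
        act (u \<otimes>\<^bsub>UA n \<epsilon>\<^esub> u') v = act u (act u' v)) \<and>
     (\<forall>c. \<forall>v\<in>M. act (UA_scalar n \<epsilon> c) v = c *\<^sub>K v)"

definition UA_irreducible ::
  "nat \<Rightarrow> (nat \<Rightarrow> nat) \<Rightarrow> ('a \<Rightarrow>\<^sub>0 kfield) set \<Rightarrow>
     (falg set \<Rightarrow> ('a \<Rightarrow>\<^sub>0 kfield) \<Rightarrow> ('a \<Rightarrow>\<^sub>0 kfield)) \<Rightarrow> bool" where
  "UA_irreducible n \<epsilon> M act \<longleftrightarrow>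
     UA_module n \<epsilon> M act \<and> M \<noteq> {0} \<and>
     (\<forall>S. S \<subseteq> M \<and> UA_module n \<epsilon> S act \<longrightarrow> S = {0} \<or> S = M)"

text \<open>The action of the quotient algebra induced by an action of the free algebra. A coset acts by
  the common value of its representatives. That they agree on the modules below is a consequence of
  the defining relations.\<close>

definition induced_action :: "(falg \<Rightarrow> 'v \<Rightarrow> 'v) \<Rightarrow> falg set \<Rightarrow> 'v \<Rightarrow> 'v" where
  "induced_action \<rho> u v = the_elem ((\<lambda>a. \<rho> a v) ` u)"


section \<open>The spaces \<open>\<W>\<^sub>l\<close> and the representation \<open>\<pi>\<^sub>z\<close>\<close>

text \<open>A tuple \<open>(m\<^sub>1,\<dots>,m\<^sub>n)\<close> is a function on \<open>nat\<close> vanishing outside \<open>{1..n}\<close>. Values are integers so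
  that \<open>\<^bold>m - \<^bold>e\<^sub>i + \<^bold>e\<^sub>j\<close> makes sense without truncation.\<close>

type_synonym state = "nat \<Rightarrow> int"

definition states :: "nat \<Rightarrow> state set" where
  "states n = {m. (\<forall>i\<in>{1..<n}. m i \<in> {0, 1}) \<and> 0 \<le> m n \<and> (\<forall>i. i \<notin> {1..n} \<longrightarrow> m i = 0)}"

definition ket :: "nat \<Rightarrow> state \<Rightarrow> (state \<Rightarrow>\<^sub>0 kfield)" where
  "ket n m = (if m \<in> states n then Poly_Mapping.single m 1 else 0)"

definition W_space :: "nat \<Rightarrow> nat \<Rightarrow> (state \<Rightarrow>\<^sub>0 kfield) set" where
  "W_space n l = pm.span (ket n ` {m \<in> states n. (\<Sum>i=1..n. m i) = int l})"

definition W_tensor :: "nat \<Rightarrow> nat \<Rightarrow> nat \<Rightarrow> (state \<times> state \<Rightarrow>\<^sub>0 kfield) set" where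
  "W_tensor n l m = pm.span {tens u v | u v. u \<in> W_space n l \<and> v \<in> W_space n m}"

text \<open>\<open>move a b m\<close> is \<open>\<^bold>m - \<^bold>e\<^sub>a + \<^bold>e\<^sub>b\<close>.\<close>

definition move :: "nat \<Rightarrow> nat \<Rightarrow> state \<Rightarrow> state" where
  "move a b m = (\<lambda>j. m j - of_bool (j = a) + of_bool (j = b))"

fun pi_basis :: "nat \<Rightarrow> (nat \<Rightarrow> nat) \<Rightarrow> kfield \<Rightarrow> gen \<Rightarrow> state \<Rightarrow> (state \<Rightarrow>\<^sub>0 kfield)" where
  "pi_basis n \<epsilon> z (E i) m =
     (z powi of_bool (i = 0) * qnum (m (cyc n i))) *\<^sub>K ket n (move (cyc n i) (cyc n (i + 1)) m)"
| "pi_basis n \<epsilon> z (F i) m =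
     (z powi (- of_bool (i = 0)) * qnum (m (cyc n (i + 1)))) *\<^sub>K ket n (move (cyc n (i + 1)) (cyc n i) m)"
| "pi_basis n \<epsilon> z (K i) m =
     (q_ind \<epsilon> (cyc n i) powi (- m (cyc n i)) * q_ind \<epsilon> (cyc n (i + 1)) powi m (cyc n (i + 1)))
       *\<^sub>K ket n m"
| "pi_basis n \<epsilon> z (Ki i) m =
     inverse (q_ind \<epsilon> (cyc n i) powi (- m (cyc n i)) * q_ind \<epsilon> (cyc n (i + 1)) powi m (cyc n (i + 1)))
       *\<^sub>K ket n m"

definition pi_word ::
  "nat \<Rightarrow> (nat \<Rightarrow> nat) \<Rightarrow> kfield \<Rightarrow> gen list \<Rightarrow> (state \<Rightarrow>\<^sub>0 kfield) \<Rightarrow> (state \<Rightarrow>\<^sub>0 kfield)" where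
  "pi_word n \<epsilon> z w v = foldr (\<lambda>g. lin_ext (pi_basis n \<epsilon> z g)) w v"


section \<open>Coproduct and tensor product representation\<close>

text \<open>The coproduct and the representations are algebra homomorphisms determined by their values on
  generators; they are written here on the free algebra, and \<^const>\<open>induced_action\<close> passes to the
  quotient.\<close>

fun coproduct_gen :: "gen \<Rightarrow> (gen list \<times> gen list \<Rightarrow>\<^sub>0 kfield)" where
  "coproduct_gen (E i) = tens 1 (gn (E i)) + tens (gn (E i)) (gn (K i))"
| "coproduct_gen (F i) = tens (gn (F i)) 1 + tens (gn (Ki i)) (gn (F i))"
| "coproduct_gen (K i) = tens (gn (K i)) (gn (K i))"
| "coproduct_gen (Ki i) = tens (gn (Ki i)) (gn (Ki i))"

definition coproduct :: "falg \<Rightarrow> (gen list \<times> gen list \<Rightarrow>\<^sub>0 kfield)" where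
  "coproduct a = lin_ext (\<lambda>w. prod_list (map coproduct_gen w)) a"

text \<open>\<open>\<pi>\<^sub>z \<otimes> \<pi>\<^sub>z'\<close> on the tensor square of the free algebra.\<close>

definition pi_tensor ::
  "nat \<Rightarrow> (nat \<Rightarrow> nat) \<Rightarrow> kfield \<Rightarrow> kfield \<Rightarrow> (gen list \<times> gen list \<Rightarrow>\<^sub>0 kfield) \<Rightarrow>
     (state \<times> state \<Rightarrow>\<^sub>0 kfield) \<Rightarrow> (state \<times> state \<Rightarrow>\<^sub>0 kfield)" where
  "pi_tensor n \<epsilon> z z' t v =
     lin_ext (\<lambda>(w, w').
       lin_ext (\<lambda>(m, m'). tens (pi_word n \<epsilon> z w (ket n m)) (pi_word n \<epsilon> z' w' (ket n m'))) v) t"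

definition UA_tensor_action ::
  "nat \<Rightarrow> (nat \<Rightarrow> nat) \<Rightarrow> kfield \<Rightarrow> kfield \<Rightarrow>
     falg set \<Rightarrow> (state \<times> state \<Rightarrow>\<^sub>0 kfield) \<Rightarrow> (state \<times> state \<Rightarrow>\<^sub>0 kfield)" where
  "UA_tensor_action n \<epsilon> z z' = induced_action (\<lambda>a. pi_tensor n \<epsilon> z z' (coproduct a))"

end

theory Submission
  imports Defs
begin

text \<open>Write \<open>|0\<rangle>\<close> for the vacuum \<open>|0,\<dots>,0,l\<rangle> \<otimes> |0,\<dots>,0,m\<rangle>\<close>: all particles sit at the bosonic site \<open>n\<close>, and the fermionic
  sites \<open>1,\<dots>,n-1\<close>, each of which holds at most one particle, are empty. Irreducibility follows from
  two facts: every nonzero submodule contains \<open>|0\<rangle>\<close> (\<open>vacuum_in_submodule\<close>), and \<open>|0\<rangle>\<close> generates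
  the whole space (\<open>vacuum_generates\<close>).

  Genericity of the parameters enters through the valuation of the ground field at \<open>y = \<infinity>\<close>. Call a
  scalar bounded if its degree in \<open>y\<close> is at most zero and small if it is negative. Only the affine
  generators \<open>e\<^sub>0\<close> and \<open>f\<^sub>0\<close> involve \<open>y\<close>, and up to small terms they act on a single tensor factor:
  \<open>y\<^sup>-\<^sup>1e\<^sub>0\<close> becomes \<open>1 \<otimes> e\<^sub>0\<close> and \<open>f\<^sub>0\<close> becomes \<open>f\<^sub>0 \<otimes> 1\<close>, where \<open>e\<^sub>0\<close> and \<open>f\<^sub>0\<close> now act
  without the parameter \<open>y\<close>. This decouples the two factors, which the coproduct otherwise mixes.

  Finding the vacuum. The generators \<open>f\<^sub>0\<close> and \<open>e\<^sub>n\<^sub>-\<^sub>1\<close> move a particle to site \<open>n\<close>, whereas \<open>e\<^sub>j\<close> and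
  \<open>f\<^sub>j\<close> with \<open>1 \<le> j \<le> n-2\<close> leave the number of particles at site \<open>n\<close> unchanged. In a nonzero
  submodule consider the vectors that have as many particles at site \<open>n\<close> as possible, in the sense that
  each basis vector occurring in them has at least \<open>k\<close> of them, with \<open>k\<close> maximal. Such vectors are killed
  by \<open>f\<^sub>0\<close> and \<open>e\<^sub>n\<^sub>-\<^sub>1\<close> and stay in this class under \<open>e\<^sub>j\<close> and \<open>f\<^sub>j\<close> with \<open>1 \<le> j \<le> n-2\<close>. Normalise one
  so that its coefficients with exactly \<open>k\<close> particles at site \<open>n\<close> are bounded and one of them is \<open>1\<close>.
  Killing by \<open>f\<^sub>0\<close> makes the
  coefficients with a particle at site \<open>1\<close> of the first factor small, and applying \<open>f\<^sub>1, f\<^sub>2, \<dots>\<close> carries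
  this to the sites \<open>2, 3, \<dots>\<close> of the first factor. Killing by \<open>e\<^sub>n\<^sub>-\<^sub>1\<close> and applying
  \<open>e\<^sub>n\<^sub>-\<^sub>2, e\<^sub>n\<^sub>-\<^sub>3, \<dots>\<close> then does the same for the second factor, from site \<open>n-1\<close> down. Only the
  coefficient of the vacuum can fail to be small, so it is the one equal to \<open>1\<close>, \<open>k = l + m\<close>, and the vector is
  a multiple of \<open>|0\<rangle>\<close>.

  Generating from the vacuum. Say that a vector is approximated by a submodule if it differs from an
  element of the submodule by small coefficients. On vectors whose first factor has no fermion, \<open>y\<^sup>-\<^sup>1e\<^sub>0\<close>
  creates a particle at site \<open>1\<close> of the second factor up to small terms, and \<open>e\<^sub>1, e\<^sub>2, \<dots>\<close> move it to
  the right; this approximates every basis vector of the second factor. Then \<open>f\<^sub>n\<^sub>-\<^sub>1, f\<^sub>n\<^sub>-\<^sub>2, \<dots>\<close> fill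
  the first factor, because their other summand only changes the second factor, where everything has
  been reached already. A subspace that approximates a finite basis contains it: the matrix of the
  approximations is the identity modulo the maximal ideal of the valuation ring, hence invertible
  (\<open>supported_subset_of_approximate_basis\<close>).

  That the coproduct defines a module in the first place rests on the commutation relations of the
  operators on one tensor factor, checked on basis vectors; the ideal generated by the relations then
  acts by zero, and submodules are the subspaces stable under the free algebra (\<open>UA_module_iff\<close>).\<close>

section \<open>Linear maps on spaces with a basis\<close>

abbreviation lin :: "(('a \<Rightarrow>\<^sub>0 'k::field) \<Rightarrow> ('b \<Rightarrow>\<^sub>0 'k)) \<Rightarrow> bool" where
  "lin \<equiv> Vector_Spaces.linear smul smul"

definition supported :: "'a set \<Rightarrow> ('a \<Rightarrow>\<^sub>0 'k::field) set" where
  "supported A = {v. Poly_Mapping.keys v \<subseteq> A}"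

lemma linI:
  assumes "\<And>u v. f (u + v) = f u + f v" "\<And>c v. f (c *\<^sub>K v) = c *\<^sub>K f v"
  shows "lin f"
  by (intro Vector_Spaces.linear.intro module_hom.intro module_hom_axioms.intro pm.module_axioms
        pm.vector_space_axioms assms)

lemma lin_add: "lin f \<Longrightarrow> f (u + v) = f u + f v"
  and lin_smul: "lin f \<Longrightarrow> f (c *\<^sub>K v) = c *\<^sub>K f v"
  by (auto simp: Vector_Spaces.linear_def module_hom_def module_hom_axioms_def)

lemma lin_0: "lin f \<Longrightarrow> f 0 = 0"
  using lin_smul[of f 0 0] by simp

lemma lin_diff: "lin f \<Longrightarrow> f (u - v) = f u - f v"
  using lin_add[of f "u - v" v] by simp

lemma lin_sum: "lin f \<Longrightarrow> f (\<Sum>i\<in>I. g i) = (\<Sum>i\<in>I. f (g i))"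
  by (induction I rule: infinite_finite_induct) (auto simp: lin_0 lin_add)

lemma lin_comp: "lin f \<Longrightarrow> lin g \<Longrightarrow> lin (\<lambda>v. f (g v))"
  by (intro linI) (simp_all add: lin_add lin_smul)

lemma expand_basis:
  "v = (\<Sum>a\<in>Poly_Mapping.keys v. Poly_Mapping.lookup v a *\<^sub>K Poly_Mapping.single a 1)"
proof (rule poly_mapping_eqI)
  fix b
  have "(\<Sum>a\<in>Poly_Mapping.keys v. Poly_Mapping.lookup v a * (1 when a = b))
      = (\<Sum>a\<in>Poly_Mapping.keys v. if a = b then Poly_Mapping.lookup v b else 0)"
    by (intro sum.cong) (auto simp: when_def)
  also have "\<dots> = Poly_Mapping.lookup v b"
    by (simp add: in_keys_iff)
  finally show "Poly_Mapping.lookup v b = Poly_Mapping.lookup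
      (\<Sum>a\<in>Poly_Mapping.keys v. Poly_Mapping.lookup v a *\<^sub>K Poly_Mapping.single a 1) b"
    by (simp add: lookup_sum lookup_smul lookup_single)
qed

lemma lin_eqI:
  assumes "lin f" "lin g"
    and "\<And>a. a \<in> Poly_Mapping.keys v \<Longrightarrow> f (Poly_Mapping.single a 1) = g (Poly_Mapping.single a 1)"
  shows "f v = g v"
proof -
  have "f (\<Sum>a\<in>Poly_Mapping.keys v. Poly_Mapping.lookup v a *\<^sub>K Poly_Mapping.single a 1)
      = g (\<Sum>a\<in>Poly_Mapping.keys v. Poly_Mapping.lookup v a *\<^sub>K Poly_Mapping.single a 1)"
    unfolding lin_sum[OF assms(1)] lin_sum[OF assms(2)] lin_smul[OF assms(1)] lin_smul[OF assms(2)]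
    by (intro sum.cong refl) (simp add: assms(3))
  then show ?thesis by (simp flip: expand_basis)
qed

lemma lin_ext_superset:
  assumes "finite A" "Poly_Mapping.keys v \<subseteq> A"
  shows "lin_ext f v = (\<Sum>a\<in>A. Poly_Mapping.lookup v a *\<^sub>K f a)"
  unfolding lin_ext_def using assms
  by (intro sum.mono_neutral_left) (auto simp: in_keys_iff)

lemma lin_lin_ext [simp]:
  fixes f :: "'a \<Rightarrow> ('b \<Rightarrow>\<^sub>0 'k::field)"
  shows "lin (lin_ext f)"
proof (rule linI)
  fix u v :: "'a \<Rightarrow>\<^sub>0 'k"
  let ?A = "Poly_Mapping.keys u \<union> Poly_Mapping.keys v"
  have "lin_ext f (u + v) = (\<Sum>a\<in>?A. Poly_Mapping.lookup (u + v) a *\<^sub>K f a)"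
    using keys_add[of u v] by (intro lin_ext_superset) auto
  also have "\<dots> = (\<Sum>a\<in>?A. Poly_Mapping.lookup u a *\<^sub>K f a) + (\<Sum>a\<in>?A. Poly_Mapping.lookup v a *\<^sub>K f a)"
    by (simp add: lookup_add pm.scale_left_distrib sum.distrib)
  also have "\<dots> = lin_ext f u + lin_ext f v"
    by (subst (1 2) lin_ext_superset[of ?A]) auto
  finally show "lin_ext f (u + v) = lin_ext f u + lin_ext f v" .
next
  fix c :: 'k and v :: "'a \<Rightarrow>\<^sub>0 'k"
  have "lin_ext f (c *\<^sub>K v) = (\<Sum>a\<in>Poly_Mapping.keys v. Poly_Mapping.lookup (c *\<^sub>K v) a *\<^sub>K f a)"
    by (intro lin_ext_superset) (auto simp: in_keys_iff lookup_smul)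
  then show "lin_ext f (c *\<^sub>K v) = c *\<^sub>K lin_ext f v"
    by (simp add: lin_ext_def lookup_smul pm.scale_sum_right)
qed

lemma lin_ext_single [simp]: "lin_ext f (Poly_Mapping.single a c) = c *\<^sub>K f a"
  by (cases "c = 0") (auto simp: lin_ext_def lin_0)

lemma lin_lin_ext_param:
  assumes "\<And>a. lin (\<lambda>v. f v a)"
  shows "lin (\<lambda>v. lin_ext (f v) t)"
  by (rule linI)
     (simp_all add: lin_ext_def lin_add[OF assms] lin_smul[OF assms] sum.distrib
       pm.scale_right_distrib pm.scale_sum_right mult.commute)

lemma supported_iff: "v \<in> supported A \<longleftrightarrow> (\<forall>a. a \<notin> A \<longrightarrow> Poly_Mapping.lookup v a = 0)"
  by (auto simp: supported_def in_keys_iff)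

lemma subspace_supported: "pm.subspace (supported A)"
  by (simp add: pm.subspace_def supported_iff lookup_smul lookup_add)

lemma single_in_supported: "a \<in> A \<Longrightarrow> Poly_Mapping.single a c \<in> supported A"
  by (auto simp: supported_def)

lemma supported_eq_span: "supported A = pm.span ((\<lambda>a. Poly_Mapping.single a 1) ` A)"
proof (intro equalityI subsetI)
  fix v :: "'a \<Rightarrow>\<^sub>0 'b" assume "v \<in> supported A"
  then have "(\<Sum>a\<in>Poly_Mapping.keys v. Poly_Mapping.lookup v a *\<^sub>K Poly_Mapping.single a 1)
      \<in> pm.span ((\<lambda>a. Poly_Mapping.single a 1) ` A)"
    by (intro pm.span_sum pm.span_scale pm.span_base) (auto simp: supported_def)
  then show "v \<in> pm.span ((\<lambda>a. Poly_Mapping.single a 1) ` A)" by (simp flip: expand_basis)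
next
  fix v :: "'a \<Rightarrow>\<^sub>0 'b" assume "v \<in> pm.span ((\<lambda>a. Poly_Mapping.single a 1) ` A)"
  moreover have "pm.span ((\<lambda>a. Poly_Mapping.single a 1) ` A) \<subseteq> (supported A :: ('a \<Rightarrow>\<^sub>0 'b) set)"
    by (intro pm.span_minimal subspace_supported) (auto intro: single_in_supported)
  ultimately show "v \<in> supported A" by blast
qed

lemma lin_maps_supported:
  assumes "lin f" "v \<in> supported A" "pm.subspace B"
    and "\<And>a. a \<in> A \<Longrightarrow> f (Poly_Mapping.single a 1) \<in> B"
  shows "f v \<in> B"
proof -
  have "f (\<Sum>a\<in>Poly_Mapping.keys v. Poly_Mapping.lookup v a *\<^sub>K Poly_Mapping.single a 1) \<in> B"
    unfolding lin_sum[OF assms(1)] lin_smul[OF assms(1)] using assms(2,4)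
    by (intro pm.subspace_sum[OF assms(3)] pm.subspace_scale[OF assms(3)]) (auto simp: supported_def)
  then show ?thesis by (simp flip: expand_basis)
qed

lemma lookup_tens:
  "Poly_Mapping.lookup (tens u v) (a, b) = Poly_Mapping.lookup u a * Poly_Mapping.lookup v b"
proof -
  have "Poly_Mapping.lookup (tens u v) (a, b) =
     (\<Sum>a'\<in>Poly_Mapping.keys u. \<Sum>b'\<in>Poly_Mapping.keys v.
       if a' = a then if b' = b then Poly_Mapping.lookup u a * Poly_Mapping.lookup v b else 0 else 0)"
    by (auto simp: tens_def lookup_sum lookup_single when_def intro!: sum.cong)
  also have "\<dots> = (\<Sum>a'\<in>Poly_Mapping.keys u. if a' = a then (\<Sum>b'\<in>Poly_Mapping.keys v.
       if b' = b then Poly_Mapping.lookup u a * Poly_Mapping.lookup v b else 0) else 0)"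
    by (intro sum.cong) auto
  also have "\<dots> = Poly_Mapping.lookup u a * Poly_Mapping.lookup v b"
    by (auto simp: in_keys_iff)
  finally show ?thesis .
qed

lemma tens_eqI:
  "(\<And>a b. Poly_Mapping.lookup s (a, b) = Poly_Mapping.lookup t (a, b)) \<Longrightarrow> s = t"
  by (rule poly_mapping_eqI) auto

lemma lin_tens_left: "lin (\<lambda>u. tens u v)"
  and lin_tens_right: "lin (\<lambda>v. tens u v)"
  by (rule linI; rule tens_eqI; simp add: lookup_tens lookup_add lookup_smul algebra_simps)+

lemma tens_single [simp]:
  "tens (Poly_Mapping.single a c) (Poly_Mapping.single b d) = Poly_Mapping.single (a, b) (c * d)"
  by (rule tens_eqI) (simp add: lookup_tens lookup_single when_def)

lemma tens_zero [simp]: "tens 0 v = 0" "tens u 0 = 0"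
  by (rule tens_eqI, simp add: lookup_tens)+

lemmas tens_linear =
  lin_add[OF lin_tens_left] lin_smul[OF lin_tens_left] lin_diff[OF lin_tens_left]
  lin_add[OF lin_tens_right] lin_smul[OF lin_tens_right] lin_diff[OF lin_tens_right]

lemma tens_in_supported:
  "u \<in> supported A \<Longrightarrow> v \<in> supported B \<Longrightarrow> tens u v \<in> supported (A \<times> B)"
  by (auto simp: supported_iff lookup_tens)

lemma lin_mult_left: "lin (\<lambda>u. u * (v :: 'a::monoid_add \<Rightarrow>\<^sub>0 'k::field))"
proof (rule linI)
  fix c and u :: "'a \<Rightarrow>\<^sub>0 'k"
  show "(c *\<^sub>K u) * v = c *\<^sub>K (u * v)"
    by (simp add: smul_def mult_map_scale_conv_mult mult.assoc)
qed (simp add: distrib_right)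

lemma lin_mult_right: "lin (\<lambda>v. u * (v :: 'a::monoid_add \<Rightarrow>\<^sub>0 'k::field))"
proof (rule linI)
  fix c and v :: "'a \<Rightarrow>\<^sub>0 'k"
  have "lin (\<lambda>u :: 'a \<Rightarrow>\<^sub>0 'k. Poly_Mapping.single 0 c * u)"
  proof (rule linI)
    fix d and u :: "'a \<Rightarrow>\<^sub>0 'k"
    have "c *\<^sub>K d *\<^sub>K u = d *\<^sub>K c *\<^sub>K u" by (simp add: mult.commute)
    then show "Poly_Mapping.single 0 c * (d *\<^sub>K u) = d *\<^sub>K (Poly_Mapping.single 0 c * u)"
      by (simp only: smul_def mult_map_scale_conv_mult)
  qed (simp add: distrib_left)
  then have "u * Poly_Mapping.single 0 c = Poly_Mapping.single 0 c * u"
    by (rule lin_eqI[OF lin_mult_left]) (simp add: mult_single)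
  then show "u * (c *\<^sub>K v) = c *\<^sub>K (u * v)"
    by (simp add: smul_def mult_map_scale_conv_mult flip: mult.assoc)
qed (simp add: distrib_left)

text \<open>A homomorphism from the word monoid to an algebra extends to the free algebra; in particular the
  coproduct is multiplicative.\<close>

lemma lin_ext_mult:
  fixes f :: "'a::monoid_add \<Rightarrow> ('b::monoid_add \<Rightarrow>\<^sub>0 'k::field)"
  assumes "\<And>a b. f (a + b) = f a * f b"
  shows "lin_ext f (u * v) = lin_ext f u * lin_ext f v"
proof (rule lin_eqI[where v = u])
  show "lin (\<lambda>u. lin_ext f (u * v))" by (intro lin_comp[OF lin_lin_ext] lin_mult_left)
  show "lin (\<lambda>u. lin_ext f u * lin_ext f v)" by (intro lin_comp[OF lin_mult_left] lin_lin_ext)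
  fix a
  show "lin_ext f (Poly_Mapping.single a 1 * v) = lin_ext f (Poly_Mapping.single a 1) * lin_ext f v"
  proof (rule lin_eqI[where v = v])
    show "lin (\<lambda>v. lin_ext f (Poly_Mapping.single a 1 * v))"
      by (intro lin_comp[OF lin_lin_ext] lin_mult_right)
    show "lin (\<lambda>v. lin_ext f (Poly_Mapping.single a 1) * lin_ext f v)"
      by (intro lin_comp[OF lin_mult_right] lin_lin_ext)
  qed (simp add: mult_single assms)
qed

section \<open>The representation of the free algebra\<close>

lemma pi_word_Nil [simp]: "pi_word n \<epsilon> z [] v = v"
  and pi_word_Cons [simp]: "pi_word n \<epsilon> z (g # w) v = lin_ext (pi_basis n \<epsilon> z g) (pi_word n \<epsilon> z w v)"
  by (simp_all add: pi_word_def)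

lemma pi_word_append: "pi_word n \<epsilon> z (w @ w') v = pi_word n \<epsilon> z w (pi_word n \<epsilon> z w' v)"
  by (simp add: pi_word_def)

lemma lin_pi_word: "lin (pi_word n \<epsilon> z w)"
proof (induction w)
  case Nil then show ?case by (auto intro: linI)
next
  case (Cons g w) then show ?case using lin_comp[OF lin_lin_ext Cons] by simp
qed

lemma ket_state: "m \<in> states n \<Longrightarrow> ket n m = Poly_Mapping.single m 1"
  by (simp add: ket_def)

lemma ket_in_supported: "ket n m \<in> supported (states n)"
  by (auto simp: ket_def supported_def)

lemma pi_basis_in_supported: "pi_basis n \<epsilon> z g m \<in> supported (states n)"
  by (cases g) (auto intro!: pm.subspace_scale[OF subspace_supported] ket_in_supported)

lemma pi_word_in_supported:
  "v \<in> supported (states n) \<Longrightarrow> pi_word n \<epsilon> z w v \<in> supported (states n)"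
  by (induction w)
     (auto intro: lin_maps_supported[OF lin_lin_ext _ subspace_supported] simp: pi_basis_in_supported)

text \<open>The operator of a pair of words. It exhibits \<^const>\<open>pi_tensor\<close> as a linear extension over such
  pairs, so that multiplicativity needs to be checked on words only.\<close>

definition word_tensor where
  "word_tensor n \<epsilon> z z' = (\<lambda>(w, w') v. lin_ext (\<lambda>(m, m').
     tens (pi_word n \<epsilon> z w (ket n m)) (pi_word n \<epsilon> z' w' (ket n m'))) v)"

lemma pi_tensor_eq: "pi_tensor n \<epsilon> z z' t v = lin_ext (\<lambda>p. word_tensor n \<epsilon> z z' p v) t"
  by (simp add: pi_tensor_def word_tensor_def case_prod_unfold)

lemma lin_word_tensor: "lin (word_tensor n \<epsilon> z z' p)"
  by (cases p) (simp add: word_tensor_def)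

lemma lin_pi_tensor: "lin (pi_tensor n \<epsilon> z z' t)"
  and lin_pi_tensor_param: "lin (\<lambda>t. pi_tensor n \<epsilon> z z' t v)"
  unfolding pi_tensor_eq[abs_def] by (intro lin_lin_ext_param lin_word_tensor lin_lin_ext)+

text \<open>Both arguments must be combinations of states, because the operator of a pair of words is zero on
  all other basis vectors, whereas the empty word acts on a single factor by the identity.\<close>

lemma word_tensor_tens:
  assumes "u \<in> supported (states n)" "u' \<in> supported (states n)"
  shows "word_tensor n \<epsilon> z z' (w, w') (tens u u') = tens (pi_word n \<epsilon> z w u) (pi_word n \<epsilon> z' w' u')"
proof (rule lin_eqI[where v = u])
  show "lin (\<lambda>u. word_tensor n \<epsilon> z z' (w, w') (tens u u'))"
    by (intro lin_comp[OF lin_word_tensor] lin_tens_left)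
  show "lin (\<lambda>u. tens (pi_word n \<epsilon> z w u) (pi_word n \<epsilon> z' w' u'))"
    by (intro lin_comp[OF lin_tens_left] lin_pi_word)
  fix a assume "a \<in> Poly_Mapping.keys u"
  then have a: "a \<in> states n" using assms by (auto simp: supported_def)
  show "word_tensor n \<epsilon> z z' (w, w') (tens (Poly_Mapping.single a 1) u')
      = tens (pi_word n \<epsilon> z w (Poly_Mapping.single a 1)) (pi_word n \<epsilon> z' w' u')"
  proof (rule lin_eqI[where v = u'])
    show "lin (\<lambda>u'. word_tensor n \<epsilon> z z' (w, w') (tens (Poly_Mapping.single a 1) u'))"
      by (intro lin_comp[OF lin_word_tensor] lin_tens_right)
    show "lin (\<lambda>u'. tens (pi_word n \<epsilon> z w (Poly_Mapping.single a 1)) (pi_word n \<epsilon> z' w' u'))"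
      by (intro lin_comp[OF lin_tens_right] lin_pi_word)
    fix b assume "b \<in> Poly_Mapping.keys u'"
    then have b: "b \<in> states n" using assms by (auto simp: supported_def)
    from a b show "word_tensor n \<epsilon> z z' (w, w') (tens (Poly_Mapping.single a 1) (Poly_Mapping.single b 1))
      = tens (pi_word n \<epsilon> z w (Poly_Mapping.single a 1)) (pi_word n \<epsilon> z' w' (Poly_Mapping.single b 1))"
      by (simp add: word_tensor_def ket_state)
  qed
qed

lemma word_tensor_mult:
  "word_tensor n \<epsilon> z z' (p + p') v = word_tensor n \<epsilon> z z' p (word_tensor n \<epsilon> z z' p' v)"
proof (rule lin_eqI[OF lin_word_tensor lin_comp[OF lin_word_tensor lin_word_tensor]])
  fix a :: "state \<times> state"
  obtain w w' where p: "p = (w, w')" by force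
  obtain u u' where p': "p' = (u, u')" by force
  obtain m m' where a: "a = (m, m')" by force
  show "word_tensor n \<epsilon> z z' (p + p') (Poly_Mapping.single a 1) =
    word_tensor n \<epsilon> z z' p (word_tensor n \<epsilon> z z' p' (Poly_Mapping.single a 1))"
    unfolding p p' a
    using word_tensor_tens[OF pi_word_in_supported[OF ket_in_supported]
        pi_word_in_supported[OF ket_in_supported], of n \<epsilon> z z' w w' \<epsilon> z u m \<epsilon> z' u' m']
    by (simp add: word_tensor_def plus_list_def pi_word_append)
qed

lemma pi_tensor_mult:
  "pi_tensor n \<epsilon> z z' (s * t) v = pi_tensor n \<epsilon> z z' s (pi_tensor n \<epsilon> z z' t v)"
proof (rule lin_eqI[where v = s])
  show "lin (\<lambda>s. pi_tensor n \<epsilon> z z' (s * t) v)"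
    by (intro lin_comp[OF lin_pi_tensor_param] lin_mult_left)
  show "lin (\<lambda>s. pi_tensor n \<epsilon> z z' s (pi_tensor n \<epsilon> z z' t v))" by (rule lin_pi_tensor_param)
  fix p
  show "pi_tensor n \<epsilon> z z' (Poly_Mapping.single p 1 * t) v
      = pi_tensor n \<epsilon> z z' (Poly_Mapping.single p 1) (pi_tensor n \<epsilon> z z' t v)"
  proof (rule lin_eqI[where v = t])
    show "lin (\<lambda>t. pi_tensor n \<epsilon> z z' (Poly_Mapping.single p 1 * t) v)"
      by (intro lin_comp[OF lin_pi_tensor_param] lin_mult_right)
    show "lin (\<lambda>t. pi_tensor n \<epsilon> z z' (Poly_Mapping.single p 1) (pi_tensor n \<epsilon> z z' t v))"
      by (intro lin_comp[OF lin_pi_tensor] lin_pi_tensor_param)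
  qed (simp add: mult_single pi_tensor_eq word_tensor_mult)
qed

lemma coproduct_mult: "coproduct (a * b) = coproduct a * coproduct b"
  unfolding coproduct_def by (rule lin_ext_mult) (simp add: plus_list_def)

lemma single_list_one: "(1 :: 'a list \<Rightarrow>\<^sub>0 'k::field) = Poly_Mapping.single [] 1"
  by (simp flip: single_one add: zero_list_def)

lemma coproduct_one: "coproduct 1 = 1"
  by (simp add: coproduct_def single_list_one)

lemma coproduct_gn: "coproduct (gn g) = coproduct_gen g"
  by (simp add: coproduct_def gn_def)

text \<open>The action of the free algebra from which \<^const>\<open>UA_tensor_action\<close> is induced.\<close>

definition rho where
  "rho n \<epsilon> z z' a = pi_tensor n \<epsilon> z z' (coproduct a)"

lemma lin_rho: "lin (rho n \<epsilon> z z' a)"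
  and lin_rho_param: "lin (\<lambda>a. rho n \<epsilon> z z' a v)"
  unfolding rho_def coproduct_def
  by (intro lin_pi_tensor lin_comp[OF lin_pi_tensor_param] lin_lin_ext)+

lemma rho_mult: "rho n \<epsilon> z z' (a * b) v = rho n \<epsilon> z z' a (rho n \<epsilon> z z' b v)"
  by (simp add: rho_def coproduct_mult pi_tensor_mult)

lemma rho_one:
  assumes "v \<in> supported (states n \<times> states n)"
  shows "rho n \<epsilon> z z' 1 v = v"
proof -
  have one: "(1 :: gen list \<times> gen list \<Rightarrow>\<^sub>0 kfield) = Poly_Mapping.single ([], []) 1"
    by (simp flip: single_one add: zero_prod_def zero_list_def)
  have "rho n \<epsilon> z z' 1 v = word_tensor n \<epsilon> z z' ([], []) v"
    unfolding rho_def coproduct_one pi_tensor_eq one lin_ext_single by simp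
  also have "\<dots> = v"
  proof (rule lin_eqI[OF lin_word_tensor, where g = "\<lambda>v. v"])
    show "lin (\<lambda>v. v)" by (auto intro: linI)
    fix a assume "a \<in> Poly_Mapping.keys v"
    with assms show "word_tensor n \<epsilon> z z' ([], []) (Poly_Mapping.single a 1) = Poly_Mapping.single a 1"
      by (cases a) (auto simp: supported_def word_tensor_def ket_state)
  qed
  finally show ?thesis .
qed

lemma rho_gen_tens:
  assumes "u \<in> supported (states n)" "u' \<in> supported (states n)"
  shows "rho n \<epsilon> z z' (gn (E i)) (tens u u') =
      tens u (lin_ext (pi_basis n \<epsilon> z' (E i)) u')
      + tens (lin_ext (pi_basis n \<epsilon> z (E i)) u) (lin_ext (pi_basis n \<epsilon> z' (K i)) u')"
    and "rho n \<epsilon> z z' (gn (F i)) (tens u u') =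
      tens (lin_ext (pi_basis n \<epsilon> z (F i)) u) u'
      + tens (lin_ext (pi_basis n \<epsilon> z (Ki i)) u) (lin_ext (pi_basis n \<epsilon> z' (F i)) u')"
    and "rho n \<epsilon> z z' (gn (K i)) (tens u u') =
      tens (lin_ext (pi_basis n \<epsilon> z (K i)) u) (lin_ext (pi_basis n \<epsilon> z' (K i)) u')"
    and "rho n \<epsilon> z z' (gn (Ki i)) (tens u u') =
      tens (lin_ext (pi_basis n \<epsilon> z (Ki i)) u) (lin_ext (pi_basis n \<epsilon> z' (Ki i)) u')"
  unfolding rho_def coproduct_gn pi_tensor_eq using assms
  by (simp_all add: gn_def single_list_one lin_add[OF lin_lin_ext] word_tensor_tens)

section \<open>Constants, boundedness and smallness in the ground field\<close>

text \<open>Fractions are taken with respect to the outermost variable \<open>y\<close>. The constants are the field of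
  rational functions free of \<open>y\<close>; the bounded elements form the valuation ring at \<open>y = \<infinity>\<close>, and the
  small ones its maximal ideal. Every matrix coefficient of the generators is a constant times a power
  of \<open>y\<close>.\<close>

definition consts_y :: "'a::idom poly fract set" where
  "consts_y = {Fract [:a:] [:b:] | a b. b \<noteq> 0}"

definition bounded_y :: "'a::idom poly fract set" where
  "bounded_y = {Fract a b | a b. b \<noteq> 0 \<and> degree a \<le> degree b}"

definition small_y :: "'a::idom poly fract set" where
  "small_y = {Fract a b | a b. degree a < degree b}"

lemma consts_y_of_poly: "Fract [:a:] 1 \<in> consts_y"
  unfolding consts_y_def by (intro CollectI exI[of _ a] exI[of _ 1]) (simp flip: one_pCons)

lemma consts_y_0 [simp]: "0 \<in> consts_y" and consts_y_1 [simp]: "1 \<in> consts_y"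
  using consts_y_of_poly[of 0] consts_y_of_poly[of 1] by (simp_all add: fract_collapse flip: one_pCons)

lemma consts_y_add: "c \<in> consts_y \<Longrightarrow> d \<in> consts_y \<Longrightarrow> c + d \<in> consts_y"
  and consts_y_mult: "c \<in> consts_y \<Longrightarrow> d \<in> consts_y \<Longrightarrow> c * d \<in> consts_y"
  and consts_y_uminus: "c \<in> consts_y \<Longrightarrow> - c \<in> consts_y"
proof -
  { fix a b a' b' :: 'a assume "b \<noteq> 0" "b' \<noteq> 0"
    then have "Fract [:a:] [:b:] + Fract [:a':] [:b':] = Fract [:a * b' + a' * b:] [:b * b':]"
      and "Fract [:a:] [:b:] * Fract [:a':] [:b':] = Fract [:a * a':] [:b * b':]"
      and "- Fract [:a:] [:b:] = Fract [:- a:] [:b:]"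
      by (simp_all add: algebra_simps) }
  note * = this
  show "c \<in> consts_y \<Longrightarrow> d \<in> consts_y \<Longrightarrow> c + d \<in> consts_y"
    "c \<in> consts_y \<Longrightarrow> d \<in> consts_y \<Longrightarrow> c * d \<in> consts_y"
    unfolding consts_y_def by (clarsimp simp: *, metis no_zero_divisors)+
  show "c \<in> consts_y \<Longrightarrow> - c \<in> consts_y"
    unfolding consts_y_def using * by blast
qed

lemma consts_y_inverse: "c \<in> consts_y \<Longrightarrow> inverse c \<in> consts_y"
proof -
  assume "c \<in> consts_y"
  then obtain a b where c: "c = Fract [:a:] [:b:]" "b \<noteq> 0" by (auto simp: consts_y_def)
  show ?thesis
  proof (cases "a = 0")
    case True then show ?thesis using c by (simp add: fract_collapse)
  next
    case False then show ?thesis using c by (auto simp: consts_y_def)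
  qed
qed

lemma consts_y_diff: "c \<in> consts_y \<Longrightarrow> d \<in> consts_y \<Longrightarrow> c - d \<in> consts_y"
  using consts_y_add[of c "- d"] consts_y_uminus[of d] by simp

lemma consts_y_divide: "c \<in> consts_y \<Longrightarrow> d \<in> consts_y \<Longrightarrow> c / d \<in> consts_y"
  using consts_y_mult[of c "inverse d"] consts_y_inverse[of d] by (simp add: divide_inverse)

lemma consts_y_power: "c \<in> consts_y \<Longrightarrow> c ^ k \<in> consts_y"
  by (induction k) (auto intro: consts_y_mult)

lemma consts_y_powi: "c \<in> consts_y \<Longrightarrow> c powi k \<in> consts_y"
  by (auto simp: power_int_def intro: consts_y_power consts_y_inverse)

lemmas consts_y_intros = consts_y_add consts_y_diff consts_y_mult consts_y_uminus consts_y_inverse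
  consts_y_divide consts_y_powi

lemma consts_y_bounded: "c \<in> consts_y \<Longrightarrow> c \<in> bounded_y"
  unfolding consts_y_def bounded_y_def by force

lemma small_y_bounded: "c \<in> small_y \<Longrightarrow> c \<in> bounded_y"
  unfolding small_y_def bounded_y_def by force

lemma bounded_y_add: "c \<in> bounded_y \<Longrightarrow> d \<in> bounded_y \<Longrightarrow> c + d \<in> bounded_y"
proof -
  assume "c \<in> bounded_y" "d \<in> bounded_y"
  then obtain a b a' b' where *: "c = Fract a b" "b \<noteq> 0" "degree a \<le> degree b"
    "d = Fract a' b'" "b' \<noteq> 0" "degree a' \<le> degree b'" by (auto simp: bounded_y_def)
  have "degree (a * b' + a' * b) \<le> degree (b * b')"
    using * degree_mult_le[of a b'] degree_mult_le[of a' b]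
    by (intro degree_add_le) (auto simp: degree_mult_eq)
  then show ?thesis using * by (auto simp: bounded_y_def intro!: exI)
qed

lemma bounded_y_mult: "c \<in> bounded_y \<Longrightarrow> d \<in> bounded_y \<Longrightarrow> c * d \<in> bounded_y"
proof -
  assume "c \<in> bounded_y" "d \<in> bounded_y"
  then obtain a b a' b' where *: "c = Fract a b" "b \<noteq> 0" "degree a \<le> degree b"
    "d = Fract a' b'" "b' \<noteq> 0" "degree a' \<le> degree b'" by (auto simp: bounded_y_def)
  have "degree (a * a') \<le> degree (b * b')"
    using * degree_mult_le[of a a'] by (auto simp: degree_mult_eq)
  then show ?thesis using * by (auto simp: bounded_y_def intro!: exI)
qed

lemma small_y_0 [simp]: "0 \<in> small_y"
  unfolding small_y_def
  by (intro CollectI exI[of _ 0] exI[of _ "[:0, 1:]"]) (simp add: fract_collapse)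

lemma small_y_add: "c \<in> small_y \<Longrightarrow> d \<in> small_y \<Longrightarrow> c + d \<in> small_y"
proof -
  assume "c \<in> small_y" "d \<in> small_y"
  then obtain a b a' b' where *: "c = Fract a b" "degree a < degree b"
    "d = Fract a' b'" "degree a' < degree b'" by (auto simp: small_y_def)
  then have nz: "b \<noteq> 0" "b' \<noteq> 0" by auto
  have "degree (a * b' + a' * b) < degree (b * b')"
    using * nz degree_mult_le[of a b'] degree_mult_le[of a' b]
    by (intro degree_add_less) (auto simp: degree_mult_eq)
  then show ?thesis using * nz by (auto simp: small_y_def intro!: exI)
qed

lemma bounded_small_mult: "c \<in> bounded_y \<Longrightarrow> d \<in> small_y \<Longrightarrow> c * d \<in> small_y"
proof -
  assume "c \<in> bounded_y" "d \<in> small_y"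
  then obtain a b a' b' where *: "c = Fract a b" "b \<noteq> 0" "degree a \<le> degree b"
    "d = Fract a' b'" "degree a' < degree b'" by (auto simp: bounded_y_def small_y_def)
  then have nz: "b' \<noteq> 0" by auto
  have "degree (a * a') < degree (b * b')"
    using * nz degree_mult_le[of a a'] by (auto simp: degree_mult_eq)
  then show ?thesis using * nz by (auto simp: small_y_def intro!: exI)
qed

lemma const_small: "c \<in> consts_y \<Longrightarrow> d \<in> small_y \<Longrightarrow> c * d \<in> small_y"
  by (rule bounded_small_mult[OF consts_y_bounded])

lemma const_bounded: "c \<in> consts_y \<Longrightarrow> d \<in> bounded_y \<Longrightarrow> c * d \<in> bounded_y"
  by (rule bounded_y_mult[OF consts_y_bounded])

lemma zero_bounded: "0 \<in> bounded_y"
  by (intro consts_y_bounded consts_y_0)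

lemma small_y_uminus: "c \<in> small_y \<Longrightarrow> - c \<in> small_y"
  using const_small[OF consts_y_uminus[OF consts_y_1]] by fastforce

lemma small_y_diff: "c \<in> small_y \<Longrightarrow> d \<in> small_y \<Longrightarrow> c - d \<in> small_y"
  using small_y_add[of c "- d"] small_y_uminus[of d] by simp

lemma one_not_small_y: "1 \<notin> small_y"
proof
  assume "1 \<in> (small_y :: 'a poly fract set)"
  then obtain a b :: "'a poly" where *: "Fract a b = 1" "degree a < degree b"
    by (auto simp: small_y_def)
  then have "b \<noteq> 0" by auto
  with * show False by (simp add: One_fract_def eq_fract)
qed

lemma bounded_or_inverse_bounded: "c \<in> bounded_y \<or> inverse c \<in> bounded_y"
proof (cases c)
  case (Fract a b)
  show ?thesis
  proof (cases "degree a \<le> degree b")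
    case True then show ?thesis using Fract by (auto simp: bounded_y_def)
  next
    case False then show ?thesis using Fract by (auto simp: bounded_y_def intro!: exI)
  qed
qed

text \<open>An element of maximal degree dominates the others; it serves to normalise a vector.\<close>

lemma finite_bounded_by_member:
  assumes "finite D" "D \<noteq> {}" "0 \<notin> D"
  shows "\<exists>u\<in>D. \<forall>c\<in>D. c / u \<in> bounded_y"
  using assms
proof (induction D rule: finite_ne_induct)
  case (singleton c)
  then show ?case using consts_y_bounded[OF consts_y_1] by auto
next
  case (insert c D)
  then obtain u where u: "u \<in> D" "\<And>d. d \<in> D \<Longrightarrow> d / u \<in> bounded_y" by auto
  show ?case
  proof (cases "c / u \<in> bounded_y")
    case True then show ?thesis using u by auto
  next
    case False
    then have "u / c \<in> bounded_y" using bounded_or_inverse_bounded[of "c / u"] by simp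
    moreover have "u \<noteq> 0" using u(1) insert.prems by auto
    ultimately have "d / c \<in> bounded_y" if "d \<in> D" for d
      using bounded_y_mult[OF u(2)[OF that], of "u / c"] by simp
    then show ?thesis using consts_y_bounded[OF consts_y_1] insert.prems by (intro bexI[of _ c]) auto
  qed
qed

text \<open>The valuation ring is local.\<close>

lemma unit_of_small_perturbation:
  fixes c :: "'a::idom poly fract"
  assumes "c - 1 \<in> small_y"
  shows "c \<noteq> 0" "inverse c \<in> bounded_y"
proof -
  show c: "c \<noteq> 0" using assms one_not_small_y small_y_uminus[of "-1 :: 'a poly fract"] by auto
  show "inverse c \<in> bounded_y"
  proof (rule ccontr)
    assume unbounded: "inverse c \<notin> bounded_y"
    obtain a b where ab: "c - 1 = Fract a b" "degree a < degree b"
      using assms by (auto simp: small_y_def)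
    then have b: "b \<noteq> 0" by auto
    have "c = Fract a b + 1" using ab(1) by (simp add: algebra_simps)
    then have "c = Fract (a + b) b" using b by (simp add: One_fract_def)
    then have "inverse c = Fract b (a + b)" by simp
    moreover have "degree (a + b) = degree b" using ab(2) by (rule degree_add_eq_right)
    moreover have "a + b \<noteq> 0" using calculation(2) ab(2) by auto
    ultimately show False using unbounded unfolding bounded_y_def by (simp, metis order.refl)
  qed
qed

lemma y_par_nonzero: "y_par \<noteq> 0" and inverse_y_par_small: "inverse y_par \<in> small_y"
proof -
  show "y_par \<noteq> 0" by (simp add: y_par_def Zero_fract_def eq_fract)
  show "inverse y_par \<in> small_y"
    unfolding y_par_def small_y_def
      by (intro CollectI exI[of _ 1] exI[of _ "[:0, 1:]"]) simp
qed

lemma x_par_nonzero: "x_par \<noteq> 0" and x_par_consts: "x_par \<in> consts_y"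
  unfolding x_par_def by (simp add: Zero_fract_def eq_fract, rule consts_y_of_poly)

lemma q_half_power: "q_half ^ k = Fract [:[:[:0, 1:] ^ k:]:] 1"
  by (induction k) (simp_all add: q_half_def One_fract_def one_pCons)

lemma q_par_consts: "q_par \<in> consts_y"
  unfolding q_par_def q_half_power by (rule consts_y_of_poly)

lemma q_par_nonzero: "q_par \<noteq> 0"
  unfolding q_par_def q_half_power by (simp add: Zero_fract_def eq_fract)

lemma q_par_power_neq_1: "k > 0 \<Longrightarrow> q_par ^ k \<noteq> 1"
proof
  assume k: "k > 0" and "q_par ^ k = 1"
  then have "q_half ^ (2 * k) = 1" by (simp add: q_par_def power_mult)
  then have "[:0, 1:] ^ (2 * k) = (1 :: complex poly)"
    unfolding q_half_power One_fract_def by (simp add: eq_fract one_pCons)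
  then have "degree ([:0, 1:] ^ (2 * k) :: complex poly) = 0" by simp
  then show False using k by (simp add: degree_power_eq)
qed

lemma qnum_consts: "qnum m \<in> consts_y"
  unfolding qnum_def by (intro consts_y_intros q_par_consts)

lemma q_minus_inverse_nonzero: "q_par - inverse q_par \<noteq> 0"
proof
  assume "q_par - inverse q_par = 0"
  then have "q_par * q_par = 1" using q_par_nonzero by (metis eq_iff_diff_eq_0 right_inverse)
  then show False using q_par_power_neq_1[of 2] by (simp add: power2_eq_square)
qed

lemma qnum_0 [simp]: "qnum 0 = 0" and qnum_1 [simp]: "qnum 1 = 1"
  using q_minus_inverse_nonzero by (simp_all add: qnum_def power_int_minus)

lemma qnum_nonzero: "m > 0 \<Longrightarrow> qnum m \<noteq> 0"
proof
  assume "m > 0" "qnum m = 0"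
  then obtain k where k: "m = int k" "k > 0" by (metis zero_less_imp_eq_int)
  from \<open>qnum m = 0\<close> have "q_par powi m = q_par powi (- m)"
    using q_minus_inverse_nonzero by (simp add: qnum_def)
  then have "q_par ^ k = inverse (q_par ^ k)" by (simp add: k power_int_minus)
  then have "q_par ^ (k + k) = 1" using q_par_nonzero by (metis power_add power_not_zero right_inverse)
  then show False using q_par_power_neq_1[of "k + k"] k by simp
qed

section \<open>The defining relations on one tensor factor\<close>

text \<open>The products in \<^const>\<open>D_coef\<close> range over at most two sites, and both may occur when \<open>n = 2\<close>.\<close>

lemma finite_site_prod:
  fixes f :: "'a \<Rightarrow> 'b::comm_monoid_mult"
  assumes "a \<noteq> b"
  shows "(\<Prod>k\<in>{a, b} \<inter> J. f k) = (if a \<in> J then f a else 1) * (if b \<in> J then f b else 1)"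
  using assms by (simp add: Int_insert_left)

lemma move_move [simp]: "move a b (move b a m) = m"
  by (auto simp: move_def)

lemma move_commute: "move a b (move c d m) = move c d (move a b m)"
  by (auto simp: move_def)

lemma move_eq_iff: "move a b m = p \<longleftrightarrow> m = move b a p"
  by (metis move_move)

locale UA_rep =
  fixes n :: nat and \<epsilon> :: "nat \<Rightarrow> nat"
  assumes n2: "n \<ge> 2"
    and eps: "\<And>i. i \<in> {1..<n} \<Longrightarrow> \<epsilon> i = 1" "\<epsilon> n = 0"
begin

text \<open>The generator \<open>e\<^sub>i\<close> moves a particle from \<open>source i\<close> to \<open>target i\<close>, and \<open>f\<^sub>i\<close> moves it back. The
  sites \<open>1,\<dots>,n-1\<close> are fermionic and the site \<open>n\<close> is bosonic.\<close>

abbreviation source where "source i \<equiv> cyc n i"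
abbreviation target where "target i \<equiv> cyc n (Suc i)"

definition k_eigenvalue :: "nat \<Rightarrow> state \<Rightarrow> kfield" where
  "k_eigenvalue i m = q_ind \<epsilon> (source i) powi (- m (source i)) * q_ind \<epsilon> (target i) powi m (target i)"

lemma source_eq: "i < n \<Longrightarrow> source i = (if i = 0 then n else i)"
  and target_eq: "i < n \<Longrightarrow> target i = Suc i"
  using n2 by (auto simp: cyc_def mod_Suc)

lemma source_neq_target: "i < n \<Longrightarrow> source i \<noteq> target i"
  using n2 by (simp add: source_eq target_eq)

lemma site_range: "i < n \<Longrightarrow> source i \<in> {1..n}" "i < n \<Longrightarrow> target i \<in> {1..n}"
  using n2 by (auto simp: source_eq target_eq)

lemma source_inj: "i < n \<Longrightarrow> j < n \<Longrightarrow> source i = source j \<longleftrightarrow> i = j"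
  and target_inj: "i < n \<Longrightarrow> j < n \<Longrightarrow> target i = target j \<longleftrightarrow> i = j"
  by (auto simp: source_eq target_eq)

lemma q_ind_nonzero: "q_ind \<epsilon> i \<noteq> 0"
  by (simp add: q_ind_def q_par_nonzero)

lemma q_ind_consts: "q_ind \<epsilon> i \<in> consts_y"
  by (auto simp: q_ind_def intro!: consts_y_intros q_par_consts)

lemma k_eigenvalue_nonzero: "k_eigenvalue i m \<noteq> 0"
  by (simp add: k_eigenvalue_def q_ind_nonzero)

lemma k_eigenvalue_consts: "k_eigenvalue i m \<in> consts_y"
  unfolding k_eigenvalue_def by (intro consts_y_intros q_ind_consts)

lemma D_coef_eq:
  assumes "i < n" "j < n"
  shows "D_coef n \<epsilon> i j =
    (if i = j then q_ind \<epsilon> (source i) * q_ind \<epsilon> (target i)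
     else (if source i = target j then inverse (q_ind \<epsilon> (source i)) else 1)
        * (if target i = source j then inverse (q_ind \<epsilon> (target i)) else 1))"
proof -
  let ?f = "\<lambda>k. q_ind \<epsilon> k powi (2 * of_bool (i = j) - 1)"
  have "D_coef n \<epsilon> i j = (if source i \<in> {source j, target j} then ?f (source i) else 1)
      * (if target i \<in> {source j, target j} then ?f (target i) else 1)"
    unfolding D_coef_def Suc_eq_plus1[symmetric] by (rule finite_site_prod[OF source_neq_target[OF assms(1)]])
  also have "\<dots> = (if i = j then q_ind \<epsilon> (source i) * q_ind \<epsilon> (target i)
     else (if source i = target j then inverse (q_ind \<epsilon> (source i)) else 1)
        * (if target i = source j then inverse (q_ind \<epsilon> (target i)) else 1))"
    using source_inj[OF assms] target_inj[OF assms] by (simp add: power_int_minus)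
  finally show ?thesis .
qed

lemma D_coef_nonzero: "D_coef n \<epsilon> i j \<noteq> 0"
  by (simp add: D_coef_def q_ind_nonzero)

lemma D_coef_sym: "D_coef n \<epsilon> i j = D_coef n \<epsilon> j i"
  by (simp add: D_coef_def Int_commute eq_commute)

lemma k_eigenvalue_move:
  assumes "i < n" "j < n"
  shows "k_eigenvalue i (move (source j) (target j) m) = D_coef n \<epsilon> i j * k_eigenvalue i m"
proof -
  have st: "source j \<noteq> target j" "source i \<noteq> target i" using assms source_neq_target by blast+
  note [simp] = q_ind_nonzero
  show ?thesis
  proof (cases "i = j")
    case True
    then show ?thesis using st
      by (simp add: D_coef_eq[OF assms(2,2)] k_eigenvalue_def move_def power_int_diff power_int_add power_int_minus field_simps)
  next
    case False
    then have "source i \<noteq> source j" "target i \<noteq> target j" using source_inj[OF assms] target_inj[OF assms] by auto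
    then show ?thesis using False st
      by (auto simp: D_coef_eq[OF assms] k_eigenvalue_def move_def power_int_diff power_int_add power_int_minus field_simps)
  qed
qed

lemma k_eigenvalue_move':
  assumes "i < n" "j < n"
  shows "k_eigenvalue i (move (target j) (source j) m) = inverse (D_coef n \<epsilon> i j) * k_eigenvalue i m"
  using k_eigenvalue_move[OF assms, of "move (target j) (source j) m"] D_coef_nonzero[of i j]
  by (simp add: field_simps)

lemma states_iff:
  "m \<in> states n \<longleftrightarrow> (\<forall>i. 0 \<le> m i) \<and> (\<forall>i. i \<noteq> n \<longrightarrow> m i \<le> 1) \<and> (\<forall>i. i \<notin> {1..n} \<longrightarrow> m i = 0)"
proof (intro iffI conjI allI impI)
  fix i assume m: "m \<in> states n"
  consider "i \<in> {1..<n}" | "i = n" | "i \<notin> {1..n}" using n2 by force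
  then show "0 \<le> m i" using m by cases (force simp: states_def)+
next
  fix i assume m: "m \<in> states n" and "i \<noteq> n"
  then consider "i \<in> {1..<n}" | "i \<notin> {1..n}" by force
  then show "m i \<le> 1" using m by cases (force simp: states_def)+
next
  fix i assume "m \<in> states n" "i \<notin> {1..n}"
  then show "m i = 0" by (simp add: states_def)
next
  assume *: "(\<forall>i. 0 \<le> m i) \<and> (\<forall>i. i \<noteq> n \<longrightarrow> m i \<le> 1) \<and> (\<forall>i. i \<notin> {1..n} \<longrightarrow> m i = 0)"
  have "m i \<in> {0, 1}" if "i \<noteq> n" for i
  proof -
    from * that have "0 \<le> m i" "m i \<le> 1" by auto
    then have "m i = 0 \<or> m i = 1" by linarith
    then show ?thesis by simp
  qed
  then show "m \<in> states n" using * by (auto simp: states_def)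
qed

lemma move_in_states_iff:
  assumes "a \<noteq> b" "a \<in> {1..n}" "b \<in> {1..n}" "m \<in> states n"
  shows "move a b m \<in> states n \<longleftrightarrow> 1 \<le> m a \<and> (b \<noteq> n \<longrightarrow> m b = 0)"
proof
  assume r: "move a b m \<in> states n"
  have "0 \<le> move a b m a" "b \<noteq> n \<Longrightarrow> move a b m b \<le> 1" "0 \<le> m b"
    using r assms(4) by (simp_all add: states_iff)
  then show "1 \<le> m a \<and> (b \<noteq> n \<longrightarrow> m b = 0)" using assms(1) by (auto simp: move_def)
next
  assume *: "1 \<le> m a \<and> (b \<noteq> n \<longrightarrow> m b = 0)"
  show "move a b m \<in> states n"
    unfolding states_iff
  proof (intro conjI allI impI)
    fix i
    have m: "0 \<le> m i" "i \<noteq> n \<longrightarrow> m i \<le> 1" "i \<notin> {1..n} \<longrightarrow> m i = 0"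
      using assms(4) by (auto simp: states_iff)
    show "0 \<le> move a b m i" using * m by (auto simp: move_def)
    show "move a b m i \<le> 1" if "i \<noteq> n" using * m that by (auto simp: move_def)
    show "move a b m i = 0" if "i \<notin> {1..n}" using that assms(2,3) m by (auto simp: move_def)
  qed
qed

lemma lin_ext_ket: "lin_ext f (ket n m) = (if m \<in> states n then f m else 0)"
  by (simp add: ket_def lin_0)

lemma occupation_cases:
  assumes "m \<in> states n" "a \<noteq> n"
  obtains "m a = 0" | "m a = 1"
proof -
  have "0 \<le> m a" "m a \<le> 1" using assms by (auto simp: states_iff)
  then show thesis using that by linarith
qed

lemma q_ind_eq: "a \<in> {1..n} \<Longrightarrow> q_ind \<epsilon> a = (if a = n then q_par else - inverse q_par)"
  using eps by (auto simp: q_ind_def)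

text \<open>The diagonal entry of \<open>[e\<^sub>i, f\<^sub>i]\<close>. If one of the two sites is fermionic, with occupation number
  \<open>a\<close>, then at most one of the two orders survives the exclusion principle, and the sign of
  \<open>(-q\<^sup>-\<^sup>1)\<^sup>a\<close> records which.\<close>

lemma commutator_scalar:
  assumes i: "i < n" and m: "m \<in> states n"
  shows "(if move (target i) (source i) m \<in> states n
            then qnum (m (target i)) * qnum (m (source i) + 1) else 0)
       - (if move (source i) (target i) m \<in> states n
            then qnum (m (source i)) * qnum (m (target i) + 1) else 0)
       = (k_eigenvalue i m - inverse (k_eigenvalue i m)) / (q_par - inverse q_par)"
proof -
  define a b where "a = source i" and "b = target i"
  have ab: "a \<noteq> b" "a \<in> {1..n}" "b \<in> {1..n}"
    using source_neq_target[OF i] site_range[OF i] by (simp_all add: a_def b_def)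
  note [simp] = q_par_nonzero
  have pos: "0 \<le> m a" "0 \<le> m b" using m by (auto simp: states_iff)
  have *: "move b a m \<in> states n \<longleftrightarrow> 1 \<le> m b \<and> (a \<noteq> n \<longrightarrow> m a = 0)"
    "move a b m \<in> states n \<longleftrightarrow> 1 \<le> m a \<and> (b \<noteq> n \<longrightarrow> m b = 0)"
    using ab m by (simp_all add: move_in_states_iff[OF ab m] move_in_states_iff[OF ab(1)[symmetric] ab(3,2) m])
  have k: "k_eigenvalue i m = q_ind \<epsilon> a powi (- m a) * q_ind \<epsilon> b powi m b"
    by (simp add: k_eigenvalue_def a_def b_def)
  have q: "q_ind \<epsilon> a = (if a = n then q_par else - inverse q_par)"
    "q_ind \<epsilon> b = (if b = n then q_par else - inverse q_par)"
    using ab q_ind_eq by blast+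
  have nonpos: "c = 0" if "0 \<le> c" "\<not> 1 \<le> c" for c :: int using that by linarith
  have "(if move b a m \<in> states n then qnum (m b) * qnum (m a + 1) else 0)
      - (if move a b m \<in> states n then qnum (m a) * qnum (m b + 1) else 0)
      = (k_eigenvalue i m - inverse (k_eigenvalue i m)) / (q_par - inverse q_par)"
  proof (cases "a = n")
    case True
    then have bn: "b \<noteq> n" using ab by auto
    from m bn show ?thesis
    proof (cases rule: occupation_cases)
      case 1
      then show ?thesis unfolding * k q using True bn nonpos[OF pos(1)]
        by (auto simp: qnum_def power_int_minus diff_divide_distrib)
    next
      case 2
      then show ?thesis unfolding * k q using True bn
        by (simp add: qnum_def power_int_minus power_int_add power_int_diff field_simps)
    qed
  next
    case an: False
    show ?thesis
    proof (cases "b = n")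
      case True
      from m an show ?thesis
      proof (cases rule: occupation_cases)
        case 1
        then show ?thesis unfolding * k q using True an nonpos[OF pos(2)]
          by (auto simp: qnum_def power_int_minus diff_divide_distrib)
      next
        case 2
        then show ?thesis unfolding * k q using True an
          by (simp add: qnum_def power_int_minus power_int_add power_int_diff field_simps)
      qed
    next
      case bn: False
      from m an show ?thesis
      proof (cases rule: occupation_cases)
        case a: 1
        from m bn show ?thesis
        proof (cases rule: occupation_cases)
          case 1 then show ?thesis unfolding * k q using an bn a by simp
        next
          case 2 then show ?thesis unfolding * k q using an bn a q_minus_inverse_nonzero
            by (simp add: power_int_minus)
        qed
      next
        case a: 2
        from m bn show ?thesis
        proof (cases rule: occupation_cases)
          case 1 then show ?thesis unfolding * k q using an bn a q_minus_inverse_nonzero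
            by (simp add: power_int_minus field_simps)
        next
          case 2 then show ?thesis unfolding * k q using an bn a
            by (simp add: power_int_minus)
        qed
      qed
    qed
  qed
  then show ?thesis by (simp only: a_def b_def)
qed

abbreviation op where "op z g \<equiv> lin_ext (pi_basis n \<epsilon> z g)"

lemma op_E: "op z (E i) (ket n m) = (if m \<in> states n then
    (z powi of_bool (i = 0) * qnum (m (source i))) *\<^sub>K ket n (move (source i) (target i) m) else 0)"
  and op_F: "op z (F i) (ket n m) = (if m \<in> states n then
    (z powi (- of_bool (i = 0)) * qnum (m (target i))) *\<^sub>K ket n (move (target i) (source i) m) else 0)"
  and op_K: "op z (K i) (ket n m) = k_eigenvalue i m *\<^sub>K ket n m"
  and op_Ki: "op z (Ki i) (ket n m) = inverse (k_eigenvalue i m) *\<^sub>K ket n m"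
  by (simp_all add: lin_ext_ket k_eigenvalue_def) (simp_all add: ket_def)

text \<open>Consider two moves whose result is a state, where the second does not take away what the first has
  put down. They could still pass through a vector with an index out of range, but only if the first
  starts from an empty site, and then its coefficient is zero.\<close>

lemma intermediate_state:
  assumes "c \<noteq> d" "a \<noteq> d" "{c, d} \<subseteq> {1..n}"
    and "m \<in> states n" "move a b (move c d m) \<in> states n" "m c \<noteq> 0"
  shows "move c d m \<in> states n"
proof -
  have "0 \<le> m c" using assms(4) by (auto simp: states_iff)
  then have "1 \<le> m c" using assms(6) by linarith
  moreover have "m d = 0" if "d \<noteq> n"
  proof -
    have "move a b (move c d m) d \<le> 1" "0 \<le> m d" using assms(4,5) that by (simp_all add: states_iff)
    then show ?thesis using assms(1,2) by (cases "d = b") (auto simp: move_def)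
  qed
  ultimately show ?thesis using assms by (subst move_in_states_iff) auto
qed

text \<open>The operators \<open>e\<^sub>i\<close> and \<open>f\<^sub>j\<close> shift occupation numbers at distinct ends, so both orders give the
  same target. The coefficients agree as well: they are \<open>[a][b]\<close> if the two moves start from distinct
  sites and \<open>[a][a-1]\<close> if they start from the same site.\<close>

lemma commutator_neq:
  assumes i: "i < n" and j: "j < n" and neq: "i \<noteq> j" and m: "m \<in> states n"
  shows "op z (E i) (op z (F j) (ket n m)) = op z (F j) (op z (E i) (ket n m))"
proof (cases "move (source i) (target i) (move (target j) (source j) m) \<in> states n")
  case True
  note st = source_neq_target[OF i] source_neq_target[OF j]
  have neq': "source i \<noteq> source j" "target i \<noteq> target j"
    using neq source_inj[OF i j] target_inj[OF i j] by auto
  note True' = True[unfolded move_commute[of "source i"]]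
  have coef: "qnum (m (target j)) * qnum (move (target j) (source j) m (source i))
      = qnum (m (source i)) * qnum (move (source i) (target i) m (target j))"
    using st neq' by (auto simp: move_def)
  have 1: "move (target j) (source j) m \<in> states n" if "m (target j) \<noteq> 0"
    by (rule intermediate_state[OF _ _ _ m True that]) (use st neq' site_range i j in auto)
  have 2: "move (source i) (target i) m \<in> states n" if "m (source i) \<noteq> 0"
    by (rule intermediate_state[OF _ _ _ m True' that]) (use st neq' site_range i j in auto)
  have "op z (E i) (op z (F j) (ket n m)) =
     (z powi (- of_bool (j = 0)) * z powi of_bool (i = 0)
      * (qnum (m (target j)) * qnum (move (target j) (source j) m (source i))))
      *\<^sub>K ket n (move (source i) (target i) (move (target j) (source j) m))"
    using m 1 by (cases "m (target j) = 0") (simp_all add: op_E op_F lin_0 lin_smul mult_ac)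
  moreover have "op z (F j) (op z (E i) (ket n m)) =
     (z powi (- of_bool (j = 0)) * z powi of_bool (i = 0)
      * (qnum (m (source i)) * qnum (move (source i) (target i) m (target j))))
      *\<^sub>K ket n (move (target j) (source j) (move (source i) (target i) m))"
    using m 2 by (cases "m (source i) = 0") (simp_all add: op_E op_F lin_0 lin_smul mult_ac)
  ultimately show ?thesis by (simp only: coef move_commute[of "source i"])
next
  case False
  note False' = False[unfolded move_commute[of "source i"]]
  have "ket n (move (source i) (target i) (move (target j) (source j) m)) = 0"
    "ket n (move (target j) (source j) (move (source i) (target i) m)) = 0"
    using False False' by (simp_all add: ket_def)
  then show ?thesis by (simp add: op_E op_F lin_0 lin_smul)
qed

lemma commutator_eq:
  assumes i: "i < n" and z: "z \<noteq> 0" and m: "m \<in> states n"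
  shows "op z (E i) (op z (F i) (ket n m)) - op z (F i) (op z (E i) (ket n m))
    = ((k_eigenvalue i m - inverse (k_eigenvalue i m)) / (q_par - inverse q_par)) *\<^sub>K ket n m"
proof -
  let ?a = "if move (target i) (source i) m \<in> states n
            then qnum (m (target i)) * qnum (m (source i) + 1) else 0"
  let ?b = "if move (source i) (target i) m \<in> states n
            then qnum (m (source i)) * qnum (m (target i) + 1) else 0"
  have zz: "z powi (- of_bool (i = 0)) * z powi of_bool (i = 0) = 1" using z by simp
  have "op z (E i) (op z (F i) (ket n m)) =
      (z powi (- of_bool (i = 0)) * z powi of_bool (i = 0) * ?a) *\<^sub>K ket n m"
    using m source_neq_target[OF i] by (simp add: op_E op_F lin_0 lin_smul mult_ac) (simp add: move_def)
  moreover have "op z (F i) (op z (E i) (ket n m)) =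
      (z powi (- of_bool (i = 0)) * z powi of_bool (i = 0) * ?b) *\<^sub>K ket n m"
    using m source_neq_target[OF i] by (simp add: op_E op_F lin_0 lin_smul mult_ac) (simp add: move_def)
  ultimately have "op z (E i) (op z (F i) (ket n m)) - op z (F i) (op z (E i) (ket n m))
      = (?a - ?b) *\<^sub>K ket n m"
    by (simp only: zz mult_1 pm.scale_left_diff_distrib)
  then show ?thesis by (simp only: commutator_scalar[OF i m])
qed

end

section \<open>The defining relations on the tensor product\<close>

locale UA_tensor = UA_rep +
  fixes z z' :: kfield
  assumes zz: "z \<noteq> 0" "z' \<noteq> 0"
begin

abbreviation R where "R \<equiv> rho n \<epsilon> z z'"

lemma rho_ket:
  fixes m m' :: state
  shows "R (gn (E i)) (tens (ket n m) (ket n m')) =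
      tens (ket n m) (op z' (E i) (ket n m')) + k_eigenvalue i m' *\<^sub>K tens (op z (E i) (ket n m)) (ket n m')"
    and "R (gn (F i)) (tens (ket n m) (ket n m')) =
      tens (op z (F i) (ket n m)) (ket n m') + inverse (k_eigenvalue i m) *\<^sub>K tens (ket n m) (op z' (F i) (ket n m'))"
    and "R (gn (K i)) (tens (ket n m) (ket n m')) = (k_eigenvalue i m * k_eigenvalue i m') *\<^sub>K tens (ket n m) (ket n m')"
    and "R (gn (Ki i)) (tens (ket n m) (ket n m')) =
      inverse (k_eigenvalue i m * k_eigenvalue i m') *\<^sub>K tens (ket n m) (ket n m')"
  by (simp_all add: rho_gen_tens[OF ket_in_supported ket_in_supported] op_K op_Ki tens_linear mult_ac)

lemma K_E_relation:
  assumes ij: "i < n" "j < n"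
  shows "R (gn (K i)) (R (gn (E j)) (tens (ket n m) (ket n m'))) =
     D_coef n \<epsilon> i j *\<^sub>K R (gn (E j)) (R (gn (K i)) (tens (ket n m) (ket n m')))"
  by (simp add: rho_ket lin_add[OF lin_rho] lin_smul[OF lin_rho] lin_0[OF lin_rho] op_E tens_linear k_eigenvalue_move[OF ij]
      pm.scale_right_distrib mult_ac)

lemma K_F_relation:
  assumes ij: "i < n" "j < n"
  shows "R (gn (K i)) (R (gn (F j)) (tens (ket n m) (ket n m'))) =
     inverse (D_coef n \<epsilon> i j) *\<^sub>K R (gn (F j)) (R (gn (K i)) (tens (ket n m) (ket n m')))"
  by (simp add: rho_ket lin_add[OF lin_rho] lin_smul[OF lin_rho] lin_0[OF lin_rho] op_F tens_linear k_eigenvalue_move'[OF ij]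
      pm.scale_right_distrib mult_ac)

text \<open>Expanding the coproducts, the mixed terms \<open>f\<^sub>j \<otimes> e\<^sub>i\<close> cancel trivially and the mixed terms
  \<open>e\<^sub>ik\<^sub>j\<^sup>-\<^sup>1 \<otimes> k\<^sub>if\<^sub>j\<close> cancel because \<open>D\<close> is symmetric. What remains is
  \<open>[e\<^sub>i, f\<^sub>j] \<otimes> k\<^sub>i + k\<^sub>j\<^sup>-\<^sup>1 \<otimes> [e\<^sub>i, f\<^sub>j]\<close>, which telescopes.\<close>

lemma E_F_relation:
  assumes ij: "i < n" "j < n" and m: "m \<in> states n" "m' \<in> states n"
  shows "R (gn (E i)) (R (gn (F j)) (tens (ket n m) (ket n m')))
       - R (gn (F j)) (R (gn (E i)) (tens (ket n m) (ket n m')))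
     = (of_bool (i = j) / (q_par - inverse q_par)) *\<^sub>K
         (R (gn (K i)) (tens (ket n m) (ket n m')) - R (gn (Ki i)) (tens (ket n m) (ket n m')))"
proof -
  let ?u = "ket n m" and ?u' = "ket n m'"
  let ?e = "op z (E i)" and ?f = "op z (F j)" and ?e' = "op z' (E i)" and ?f' = "op z' (F j)"
  have "R (gn (E i)) (R (gn (F j)) (tens ?u ?u'))
      = tens (?f ?u) (?e' ?u') + k_eigenvalue i m' *\<^sub>K tens (?e (?f ?u)) ?u'
        + inverse (k_eigenvalue j m) *\<^sub>K tens ?u (?e' (?f' ?u'))
        + (inverse (k_eigenvalue j m) * inverse (D_coef n \<epsilon> i j) * k_eigenvalue i m') *\<^sub>K tens (?e ?u) (?f' ?u')"
    using m by (simp add: rho_ket lin_add[OF lin_rho] lin_smul[OF lin_rho] lin_0[OF lin_rho] op_E op_F tens_linear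
      k_eigenvalue_move'[OF ij] pm.scale_right_distrib lin_smul mult_ac add_ac)
  moreover have "R (gn (F j)) (R (gn (E i)) (tens ?u ?u'))
      = tens (?f ?u) (?e' ?u') + k_eigenvalue i m' *\<^sub>K tens (?f (?e ?u)) ?u'
        + inverse (k_eigenvalue j m) *\<^sub>K tens ?u (?f' (?e' ?u'))
        + (inverse (k_eigenvalue j m) * inverse (D_coef n \<epsilon> i j) * k_eigenvalue i m') *\<^sub>K tens (?e ?u) (?f' ?u')"
    using m by (simp add: rho_ket lin_add[OF lin_rho] lin_smul[OF lin_rho] lin_0[OF lin_rho] op_E op_F tens_linear
      k_eigenvalue_move[OF ij(2,1)] D_coef_sym[of j i] pm.scale_right_distrib lin_smul mult_ac add_ac)
  ultimately have "R (gn (E i)) (R (gn (F j)) (tens ?u ?u')) - R (gn (F j)) (R (gn (E i)) (tens ?u ?u'))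
      = k_eigenvalue i m' *\<^sub>K tens (?e (?f ?u) - ?f (?e ?u)) ?u'
        + inverse (k_eigenvalue j m) *\<^sub>K tens ?u (?e' (?f' ?u') - ?f' (?e' ?u'))"
    by (simp add: tens_linear pm.scale_right_diff_distrib)
  also have "\<dots> = (of_bool (i = j) / (q_par - inverse q_par)) *\<^sub>K
         (R (gn (K i)) (tens ?u ?u') - R (gn (Ki i)) (tens ?u ?u'))"
  proof (cases "i = j")
    case True
    note * = commutator_eq[OF ij(1) zz(1) m(1)] commutator_eq[OF ij(1) zz(2) m(2)]
    let ?d = "q_par - inverse q_par"
    have "k_eigenvalue i m' * ((k_eigenvalue i m - inverse (k_eigenvalue i m)) / ?d)
        + inverse (k_eigenvalue i m) * ((k_eigenvalue i m' - inverse (k_eigenvalue i m')) / ?d)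
        = (1 / ?d) * (k_eigenvalue i m * k_eigenvalue i m' - inverse (k_eigenvalue i m * k_eigenvalue i m'))"
      by (simp add: diff_divide_distrib right_diff_distrib mult.commute)
    then show ?thesis
      unfolding True[symmetric] *
      by (simp add: rho_ket tens_linear flip: pm.scale_left_distrib pm.scale_left_diff_distrib)
  next
    case False
    then show ?thesis using commutator_neq[OF ij False m(1)] commutator_neq[OF ij False m(2)] by simp
  qed
  finally show ?thesis .
qed

end

section \<open>The module structure\<close>

lemma free_algebra_simps [simp]:
  "monoid.mult (free_algebra n) = (*)" "one (free_algebra n) = 1"
  "ring.zero (free_algebra n) = 0" "ring.add (free_algebra n) = (+)"
  by (simp_all add: free_algebra_def)

lemma in_free_algebra:
  "a \<in> carrier (free_algebra n) \<longleftrightarrow> a \<in> supported {w. \<forall>g\<in>set w. gen_index g < n}"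
  by (auto simp: free_algebra_def supported_def)

lemma mult_in_supported:
  assumes "\<And>w w'. w \<in> A \<Longrightarrow> w' \<in> A \<Longrightarrow> w + w' \<in> A"
    and "a \<in> supported A" "b \<in> supported A"
  shows "a * b \<in> supported A"
  using assms keys_mult[of a b] unfolding supported_def by fast

lemma gn_in_free_algebra: "gen_index g < n \<Longrightarrow> gn g \<in> carrier (free_algebra n)"
  by (auto simp: in_free_algebra gn_def intro: single_in_supported)

lemma one_in_free_algebra: "1 \<in> carrier (free_algebra n)"
  by (simp add: in_free_algebra single_list_one single_in_supported)

lemma mult_in_free_algebra:
  "a \<in> carrier (free_algebra n) \<Longrightarrow> b \<in> carrier (free_algebra n) \<Longrightarrow> a * b \<in> carrier (free_algebra n)"
  unfolding in_free_algebra by (rule mult_in_supported) (auto simp: plus_list_def)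

lemma free_algebra_closed [intro]:
  shows "0 \<in> carrier (free_algebra n)"
    and "a \<in> carrier (free_algebra n) \<Longrightarrow> b \<in> carrier (free_algebra n) \<Longrightarrow> a + b \<in> carrier (free_algebra n)"
    and "a \<in> carrier (free_algebra n) \<Longrightarrow> b \<in> carrier (free_algebra n) \<Longrightarrow> a - b \<in> carrier (free_algebra n)"
    and "a \<in> carrier (free_algebra n) \<Longrightarrow> - a \<in> carrier (free_algebra n)"
    and "a \<in> carrier (free_algebra n) \<Longrightarrow> c *\<^sub>K a \<in> carrier (free_algebra n)"
  by (simp_all add: in_free_algebra pm.subspace_0 pm.subspace_add pm.subspace_diff pm.subspace_neg
      pm.subspace_scale subspace_supported)

lemma ring_free_algebra: "ring (free_algebra n)"
proof (intro ringI abelian_groupI monoidI)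
  fix a assume a: "a \<in> carrier (free_algebra n)"
  show "\<exists>b\<in>carrier (free_algebra n). b \<oplus>\<^bsub>free_algebra n\<^esub> a = \<zero>\<^bsub>free_algebra n\<^esub>"
    by (rule bexI[of _ "- a"]) (use a in auto)
qed (auto intro: mult_in_free_algebra one_in_free_algebra simp: algebra_simps)

lemma uminus_free_algebra:
  assumes "a \<in> carrier (free_algebra n)"
  shows "\<ominus>\<^bsub>free_algebra n\<^esub> a = - a"
proof -
  interpret ring "free_algebra n" by (rule ring_free_algebra)
  show ?thesis using assms by (intro minus_equality) auto
qed

lemma (in UA_rep) UA_relations_in_carrier: "UA_relations n \<epsilon> \<subseteq> carrier (free_algebra n)"
  unfolding UA_relations_def
  by (auto intro!: free_algebra_closed mult_in_free_algebra one_in_free_algebra gn_in_free_algebra)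

context UA_tensor
begin

abbreviation pairs where "pairs \<equiv> states n \<times> states n"

lemma R_in_supported: "R a v \<in> supported pairs"
proof -
  have *: "word_tensor n \<epsilon> z z' p v \<in> supported pairs" for p
  proof (rule lin_maps_supported[OF lin_word_tensor _ subspace_supported, of v UNIV])
    show "word_tensor n \<epsilon> z z' p (Poly_Mapping.single b 1) \<in> supported pairs" for b
      by (cases p; cases b)
         (simp add: word_tensor_def tens_in_supported pi_word_in_supported ket_in_supported)
  qed (simp add: supported_def)
  show ?thesis
    unfolding rho_def pi_tensor_eq
    by (rule lin_maps_supported[OF lin_lin_ext _ subspace_supported, of _ UNIV])
       (simp_all add: * supported_def[of UNIV])
qed

lemma relation_acts_zero:
  assumes a: "a \<in> UA_relations n \<epsilon>" and v: "v \<in> supported pairs"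
  shows "R a v = 0"
proof (rule lin_eqI[OF lin_rho, where g = "\<lambda>v. 0"])
  show "lin (\<lambda>v. 0)" by (auto intro: linI)
  fix b assume "b \<in> Poly_Mapping.keys v"
  then obtain m m' where b: "b = (m, m')" and m: "m \<in> states n" "m' \<in> states n"
    using v by (auto simp: supported_def)
  have *: "Poly_Mapping.single b 1 = tens (ket n m) (ket n m')"
    using m by (simp add: b ket_state)
  have supp: "tens (ket n m) (ket n m') \<in> supported pairs"
    by (intro tens_in_supported ket_in_supported)
  note lin = lin_add[OF lin_rho_param] lin_diff[OF lin_rho_param] lin_smul[OF lin_rho_param] rho_mult
  obtain i j where ij: "i < n" "j < n" and a': "a \<in> { gn (K i) * gn (Ki i) - 1,
       gn (Ki i) * gn (K i) - 1,
       gn (K i) * gn (K j) - gn (K j) * gn (K i),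
       gn (K i) * gn (E j) - D_coef n \<epsilon> i j *\<^sub>K (gn (E j) * gn (K i)),
       gn (K i) * gn (F j) - inverse (D_coef n \<epsilon> i j) *\<^sub>K (gn (F j) * gn (K i)),
       (gn (E i) * gn (F j) - gn (F j) * gn (E i))
         - (of_bool (i = j) / (q_par - inverse q_par)) *\<^sub>K (gn (K i) - gn (Ki i)) }"
    using a unfolding UA_relations_def by blast
  have kk: "inverse (k_eigenvalue i m) * inverse (k_eigenvalue i m') * (k_eigenvalue i m * k_eigenvalue i m') = 1"
    "k_eigenvalue i m * k_eigenvalue i m' * (inverse (k_eigenvalue i m) * inverse (k_eigenvalue i m')) = 1"
    using k_eigenvalue_nonzero[of i m] k_eigenvalue_nonzero[of i m'] by (simp_all add: field_simps)
  show "R a (Poly_Mapping.single b 1) = 0"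
    using a' unfolding insert_iff empty_iff *
  proof (elim disjE FalseE)
    assume "a = gn (K i) * gn (Ki i) - 1"
    then show "R a (tens (ket n m) (ket n m')) = 0"
      by (simp add: lin rho_one[OF supp] rho_ket lin_smul[OF lin_rho] kk)
  next
    assume "a = gn (Ki i) * gn (K i) - 1"
    then show "R a (tens (ket n m) (ket n m')) = 0"
      by (simp add: lin rho_one[OF supp] rho_ket lin_smul[OF lin_rho] kk)
  next
    assume "a = gn (K i) * gn (K j) - gn (K j) * gn (K i)"
    then show "R a (tens (ket n m) (ket n m')) = 0"
      by (simp add: lin rho_ket lin_smul[OF lin_rho] mult_ac)
  next
    assume "a = gn (K i) * gn (E j) - D_coef n \<epsilon> i j *\<^sub>K (gn (E j) * gn (K i))"
    then show "R a (tens (ket n m) (ket n m')) = 0" by (simp add: lin K_E_relation[OF ij])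
  next
    assume "a = gn (K i) * gn (F j) - inverse (D_coef n \<epsilon> i j) *\<^sub>K (gn (F j) * gn (K i))"
    then show "R a (tens (ket n m) (ket n m')) = 0" by (simp add: lin K_F_relation[OF ij])
  next
    assume "a = (gn (E i) * gn (F j) - gn (F j) * gn (E i))
         - (of_bool (i = j) / (q_par - inverse q_par)) *\<^sub>K (gn (K i) - gn (Ki i))"
    then show "R a (tens (ket n m) (ket n m')) = 0"
      using E_F_relation[OF ij m] by (simp add: lin)
  qed
qed

abbreviation A where "A \<equiv> free_algebra n"
abbreviation I where "I \<equiv> UA_ideal n \<epsilon>"

lemma ideal_UA: "ideal I A"
  unfolding UA_ideal_def using ring.genideal_ideal[OF ring_free_algebra UA_relations_in_carrier] .

text \<open>The annihilator of a module is an ideal, hence contains the ideal generated by the relations.\<close>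

lemma UA_ideal_acts_zero:
  assumes "a \<in> I" "v \<in> supported pairs"
  shows "R a v = 0"
proof -
  let ?I = "{a \<in> carrier A. \<forall>v\<in>supported pairs. R a v = 0}"
  interpret ring A by (rule ring_free_algebra)
  have "ideal ?I A"
  proof (rule idealI)
    show "subgroup ?I (add_monoid A)"
    proof (rule add.subgroupI)
      show "\<ominus>\<^bsub>A\<^esub> a \<in> ?I" if "a \<in> ?I" for a
      proof -
        have "R (- a) v = - R a v" for v
          using lin_diff[OF lin_rho_param[of n \<epsilon> z z' v], of 0 a] by (simp add: lin_0[OF lin_rho_param])
        then show ?thesis using that by (simp add: uminus_free_algebra free_algebra_closed)
      qed
      have "0 \<in> ?I" by (auto simp: lin_0[OF lin_rho_param])
      then show "?I \<noteq> {}" by blast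
    qed (auto simp: lin_add[OF lin_rho_param])
  qed (auto simp: rho_mult lin_0[OF lin_rho] R_in_supported intro: mult_in_free_algebra ring_free_algebra)
  moreover have "UA_relations n \<epsilon> \<subseteq> ?I"
    using UA_relations_in_carrier relation_acts_zero by auto
  ultimately have "I \<subseteq> ?I" unfolding UA_ideal_def by (rule genideal_minimal)
  then show ?thesis using assms by blast
qed

abbreviation act where "act \<equiv> UA_tensor_action n \<epsilon> z z'"

lemma act_coset:
  assumes "v \<in> supported pairs"
  shows "act (a_r_coset A I a) v = R a v"
proof -
  have coset: "a_r_coset A I a = (\<lambda>h. h + a) ` I"
    by (auto simp: a_r_coset_def')
  have "0 \<in> I"
    using additive_subgroup.zero_closed[OF ideal.axioms(1)[OF ideal_UA]] by simp
  moreover have "R (h + a) v = R a v" if "h \<in> I" for h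
    using UA_ideal_acts_zero[OF that assms] by (simp add: lin_add[OF lin_rho_param])
  ultimately have "(\<lambda>b. R b v) ` (a_r_coset A I a) = {R a v}"
    unfolding coset by force
  then show ?thesis by (simp add: UA_tensor_action_def induced_action_def flip: rho_def)
qed

text \<open>This reduces the study of submodules to subspaces stable under the free algebra.\<close>

lemma UA_module_iff:
  assumes S: "S \<subseteq> supported pairs"
  shows "UA_module n \<epsilon> S act \<longleftrightarrow> pm.subspace S \<and> (\<forall>a\<in>carrier A. \<forall>v\<in>S. R a v \<in> S)"
proof -
  interpret ideal I A by (rule ideal_UA)
  have coset: "u \<in> carrier (UA n \<epsilon>) \<longleftrightarrow> (\<exists>a\<in>carrier A. u = a_r_coset A I a)" for u
    by (auto simp: UA_def FactRing_def A_RCOSETS_def')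
  have add: "a_r_coset A I a \<oplus>\<^bsub>UA n \<epsilon>\<^esub> a_r_coset A I b = a_r_coset A I (a + b)"
    if "a \<in> carrier A" "b \<in> carrier A" for a b
    using a_rcos_sum[OF that] by (simp add: UA_def FactRing_def)
  have mult: "a_r_coset A I a \<otimes>\<^bsub>UA n \<epsilon>\<^esub> a_r_coset A I b = a_r_coset A I (a * b)"
    if "a \<in> carrier A" "b \<in> carrier A" for a b
    using rcoset_mult_add[OF that] by (simp add: UA_def FactRing_def)
  have act: "act (a_r_coset A I a) v = R a v" if "v \<in> S" for a v
    using act_coset S that by blast
  show ?thesis
  proof
    assume "UA_module n \<epsilon> S act"
    then show "pm.subspace S \<and> (\<forall>a\<in>carrier A. \<forall>v\<in>S. R a v \<in> S)"
      unfolding UA_module_def using coset act by metis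
  next
    assume *: "pm.subspace S \<and> (\<forall>a\<in>carrier A. \<forall>v\<in>S. R a v \<in> S)"
    then have add_S: "v + w \<in> S" if "v \<in> S" "w \<in> S" for v w using that by (simp add: pm.subspace_add)
    have scalar: "act (UA_scalar n \<epsilon> c) v = c *\<^sub>K v" if "v \<in> S" for c v
      using act[OF that] rho_one S that by (auto simp: UA_scalar_def lin_smul[OF lin_rho_param])
    show "UA_module n \<epsilon> S act"
      unfolding UA_module_def
      using * scalar
      by (auto simp: coset add mult act add_S lin_add[OF lin_rho] lin_add[OF lin_rho_param] rho_mult)
  qed
qed

end

section \<open>Matrix coefficients of the generators\<close>

text \<open>For constant \<open>w\<close> this says that a move preserves the number of particles; nonconstant \<open>w\<close> give the
  measures for the inductions over states below.\<close>

lemma weight_move: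
  assumes "a \<in> {1..n}" "b \<in> {1..n}"
  shows "(\<Sum>i=1..n. w i * move a b p i) = (\<Sum>i=1..n. w i * p i) - w a + w b"
proof -
  have "(\<Sum>i=1..n. w i * move a b p i)
      = (\<Sum>i=1..n. w i * p i) - (\<Sum>i=1..n. if i = a then w i else 0) + (\<Sum>i=1..n. if i = b then w i else 0)"
    unfolding sum_subtractf[symmetric] sum.distrib[symmetric]
    by (intro sum.cong) (auto simp: move_def algebra_simps)
  then show ?thesis using assms by simp
qed

context UA_rep
begin

text \<open>\<open>level l\<close> indexes the basis of \<open>\<W>\<^sub>l\<close>, and \<open>vac l\<close> is its element without fermions.\<close>

definition level :: "nat \<Rightarrow> state set" where
  "level l = {p \<in> states n. (\<Sum>i=1..n. p i) = int l}"

definition vac :: "nat \<Rightarrow> state" where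
  "vac l = (\<lambda>i. if i = n then int l else 0)"

lemma level_states: "p \<in> level l \<Longrightarrow> p \<in> states n"
  by (simp add: level_def)

lemma move_level_iff:
  assumes "a \<in> {1..n}" "b \<in> {1..n}" "p \<in> states n" "move a b p \<in> states n"
  shows "move a b p \<in> level l \<longleftrightarrow> p \<in> level l"
  using assms weight_move[OF assms(1,2), of "\<lambda>_. 1" p] by (simp add: level_def)

lemma W_tensor_eq: "W_tensor n l m = supported (level l \<times> level m)"
proof -
  have W: "W_space n l = supported (level l)" for l
  proof -
    have "ket n ` {m \<in> states n. (\<Sum>i=1..n. m i) = int l} = (\<lambda>a. Poly_Mapping.single a 1) ` level l"
      by (intro image_cong) (auto simp: level_def ket_def)
    then show ?thesis by (simp add: W_space_def supported_eq_span)
  qed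
  show ?thesis
  proof (intro equalityI)
    show "W_tensor n l m \<subseteq> supported (level l \<times> level m)"
      unfolding W_tensor_def W by (intro pm.span_minimal subspace_supported) (auto intro: tens_in_supported)
    show "supported (level l \<times> level m) \<subseteq> W_tensor n l m"
      unfolding W_tensor_def W supported_eq_span[of "level l \<times> level m"]
    proof (intro pm.span_mono subsetI)
      fix v :: "state \<times> state \<Rightarrow>\<^sub>0 kfield" assume "v \<in> (\<lambda>a. Poly_Mapping.single a 1) ` (level l \<times> level m)"
      then obtain a b where ab: "v = Poly_Mapping.single (a, b) 1" "a \<in> level l" "b \<in> level m"
        by blast
      then have "v = tens (Poly_Mapping.single a 1) (Poly_Mapping.single b 1)" by simp
      then show "v \<in> {tens u v |u v. u \<in> supported (level l) \<and> v \<in> supported (level m)}"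
        using single_in_supported[OF ab(2)] single_in_supported[OF ab(3)] by blast
    qed
  qed
qed

lemma finite_level: "finite (level l)"
proof (rule finite_subset)
  show "finite {p :: state. \<forall>i. (i \<in> {1..n} \<longrightarrow> p i \<in> {0..int l}) \<and> (i \<notin> {1..n} \<longrightarrow> p i = 0)}"
    by (rule finite_set_of_finite_funs) auto
  show "level l \<subseteq> \<dots>"
  proof (clarify, intro conjI impI)
    fix p i assume p: "p \<in> level l"
    then have nonneg: "0 \<le> p j" for j using level_states by (auto simp: states_iff)
    show "p i \<in> {0..int l}" if "i \<in> {1..n}"
      using p member_le_sum[of i "{1..n}" p] nonneg that by (auto simp: level_def)
    show "p i = 0" if "i \<notin> {1..n}" using p level_states that by (auto simp: states_iff)
  qed
qed

lemma level_boson: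
  assumes "p \<in> level l"
  shows "p n = int l - (\<Sum>i=1..<n. p i)"
proof -
  have "{1..n} = insert n {1..<n}" using n2 by auto
  then show ?thesis using assms by (simp add: level_def)
qed

lemma vac_level: "vac l \<in> level l"
proof -
  have "{1..n} = insert n {1..<n}" using n2 by auto
  then show ?thesis using n2 by (auto simp: vac_def level_def states_iff)
qed

lemma level_vacI:
  assumes p: "p \<in> level l" and 0: "\<And>i. 1 \<le> i \<Longrightarrow> i < n \<Longrightarrow> p i = 0"
  shows "p = vac l"
proof
  fix i
  consider "i = n" | "1 \<le> i" "i < n" | "i \<notin> {1..n}" by force
  then show "p i = vac l i"
  proof cases
    case 1 then show ?thesis using level_boson[OF p] 0 by (simp add: vac_def)
  next
    case 2 then show ?thesis using 0 by (simp add: vac_def)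
  next
    case 3 then show ?thesis using level_states[OF p] n2 by (auto simp: vac_def states_iff)
  qed
qed

lemma level_boson_le: "p \<in> level l \<Longrightarrow> p n \<le> int l"
  using level_boson[of p l] level_states[of p l] sum_nonneg[of "{1..<n}" p] by (auto simp: states_iff)

lemma level_boson_eq:
  assumes p: "p \<in> level l" and "p n = int l"
  shows "p = vac l"
proof (rule level_vacI[OF p])
  have "(\<Sum>i=1..<n. p i) = 0" using level_boson[OF p] assms(2) by simp
  moreover have "\<forall>i. 0 \<le> p i" using level_states[OF p] by (simp add: states_iff)
  ultimately show "p i = 0" if "1 \<le> i" "i < n" for i
    using that by (subst (asm) sum_nonneg_eq_0_iff) auto
qed

end

context UA_tensor
begin

lemma lookup_op:
  assumes "i < n" "m \<in> states n" "p \<in> states n"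
  shows "Poly_Mapping.lookup (op c (E i) (ket n m)) p =
      (if m = move (target i) (source i) p then c powi of_bool (i = 0) * qnum (p (source i) + 1) else 0)"
    and "Poly_Mapping.lookup (op c (F i) (ket n m)) p =
      (if m = move (source i) (target i) p then c powi (- of_bool (i = 0)) * qnum (p (target i) + 1) else 0)"
proof -
  have ket: "Poly_Mapping.lookup (ket n r) p = (if r = p then 1 else 0)" for r
    using assms by (auto simp: ket_def lookup_single when_def)
  show "Poly_Mapping.lookup (op c (E i) (ket n m)) p =
      (if m = move (target i) (source i) p then c powi of_bool (i = 0) * qnum (p (source i) + 1) else 0)"
    using assms source_neq_target[OF assms(1)]
    by (simp add: op_E lookup_smul ket move_eq_iff) (simp add: move_def)
  show "Poly_Mapping.lookup (op c (F i) (ket n m)) p =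
      (if m = move (source i) (target i) p then c powi (- of_bool (i = 0)) * qnum (p (target i) + 1) else 0)"
    using assms source_neq_target[OF assms(1)]
    by (simp add: op_F lookup_smul ket move_eq_iff) (simp add: move_def)
qed

text \<open>An identity that is linear in the vector may be checked on products of basis vectors.\<close>

lemma supported_pairs_induct [consumes 1, case_names subspace ket]:
  assumes "v \<in> supported pairs" "pm.subspace {v. P v}"
    and "\<And>m m'. m \<in> states n \<Longrightarrow> m' \<in> states n \<Longrightarrow> P (tens (ket n m) (ket n m'))"
  shows "P v"
  using assms(1) unfolding supported_eq_span
proof (rule pm.span_induct[OF _ assms(2)])
  fix b :: "state \<times> state \<Rightarrow>\<^sub>0 kfield"
  assume "b \<in> (\<lambda>a. Poly_Mapping.single a 1) ` pairs"
  then show "P b" using assms(3) by (auto simp: ket_def)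
qed

text \<open>The coefficients of the image are expressed through those of the vector, rather than images of
  basis vectors, since the arguments below estimate coefficients.\<close>

lemma rho_coefs:
  assumes v: "v \<in> supported pairs" and i: "i < n" and p: "p \<in> states n" "p' \<in> states n"
  shows "Poly_Mapping.lookup (R (gn (E i)) v) (p, p') =
      z' powi of_bool (i = 0) * qnum (p' (source i) + 1) *
        Poly_Mapping.lookup v (p, move (target i) (source i) p')
    + z powi of_bool (i = 0) * qnum (p (source i) + 1) * k_eigenvalue i p' *
        Poly_Mapping.lookup v (move (target i) (source i) p, p')" (is ?E)
    and "Poly_Mapping.lookup (R (gn (F i)) v) (p, p') =
      z powi (- of_bool (i = 0)) * qnum (p (target i) + 1) *
        Poly_Mapping.lookup v (move (source i) (target i) p, p')
    + z' powi (- of_bool (i = 0)) * qnum (p' (target i) + 1) * inverse (k_eigenvalue i p) *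
        Poly_Mapping.lookup v (p, move (source i) (target i) p')" (is ?F)
    and "Poly_Mapping.lookup (R (gn (K i)) v) (p, p') =
      k_eigenvalue i p * k_eigenvalue i p' * Poly_Mapping.lookup v (p, p')" (is ?K)
    and "Poly_Mapping.lookup (R (gn (Ki i)) v) (p, p') =
      inverse (k_eigenvalue i p * k_eigenvalue i p') * Poly_Mapping.lookup v (p, p')" (is ?Ki)
proof -
  note lin = lin_0[OF lin_rho] lin_add[OF lin_rho] lin_smul[OF lin_rho] lookup_add lookup_smul
  have ket: "Poly_Mapping.lookup (ket n m) r = (if m = r then 1 else 0)" if "m \<in> states n" for m r
    using that by (simp add: ket_def lookup_single when_def)
  note coef = rho_ket lookup_add lookup_smul lookup_tens lookup_op[OF i] p ket
  show ?E
    using v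
  proof (induction rule: supported_pairs_induct)
    case (ket m m')
    then show ?case
      by (cases "m = p"; cases "m' = p'"; cases "m = move (target i) (source i) p";
          cases "m' = move (target i) (source i) p'") (simp_all add: coef)
  qed (simp add: pm.subspace_def lin algebra_simps)
  show ?F
    using v
  proof (induction rule: supported_pairs_induct)
    case (ket m m')
    then show ?case
      by (cases "m = p"; cases "m' = p'"; cases "m = move (source i) (target i) p";
          cases "m' = move (source i) (target i) p'") (simp_all add: coef)
  qed (simp add: pm.subspace_def lin algebra_simps)
  show ?K
    using v
  proof (induction rule: supported_pairs_induct)
    case (ket m m')
    then show ?case by (cases "m = p"; cases "m' = p'") (simp_all add: coef)
  qed (simp add: pm.subspace_def lin algebra_simps)
  show ?Ki
    using v
  proof (induction rule: supported_pairs_induct)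
    case (ket m m')
    then show ?case by (cases "m = p"; cases "m' = p'") (simp_all add: coef)
  qed (simp add: pm.subspace_def lin algebra_simps)
qed

lemma R_gn_level:
  assumes v: "v \<in> supported (level l \<times> level m)" and g: "gen_index g < n"
  shows "R (gn g) v \<in> supported (level l \<times> level m)"
  unfolding supported_iff
proof (intro allI impI)
  fix b assume b: "b \<notin> level l \<times> level m"
  obtain p p' where pp: "b = (p, p')" by force
  have v': "v \<in> supported pairs" using v level_states by (auto simp: supported_def)
  show "Poly_Mapping.lookup (R (gn g) v) b = 0"
  proof (cases "p \<in> states n \<and> p' \<in> states n")
    case False
    then show ?thesis using R_in_supported[of "gn g" v] by (auto simp: supported_iff pp)
  next
    case True
    then have p: "p \<in> states n" "p' \<in> states n" by auto
    have zero: "Poly_Mapping.lookup v (r, r') = 0" if "r \<notin> level l \<or> r' \<notin> level m" for r r'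
      using v that by (auto simp: supported_iff)
    have mv: "move c d r \<in> level k \<longleftrightarrow> move c d r \<in> states n \<and> r \<in> level k"
      if "c \<in> {1..n}" "d \<in> {1..n}" "r \<in> states n" for c d r k
      using move_level_iff[OF that] level_states by blast
    show ?thesis
    proof (cases g)
      case (E i)
      then have i: "i < n" using g by simp
      have "Poly_Mapping.lookup v (p, move (target i) (source i) p') = 0"
        "Poly_Mapping.lookup v (move (target i) (source i) p, p') = 0"
        using b by (auto intro!: zero simp: pp mv site_range[OF i, simplified] p)
      then show ?thesis unfolding pp E rho_coefs(1)[OF v' i p] by simp
    next
      case (F i)
      then have i: "i < n" using g by simp
      have "Poly_Mapping.lookup v (p, move (source i) (target i) p') = 0"
        "Poly_Mapping.lookup v (move (source i) (target i) p, p') = 0"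
        using b by (auto intro!: zero simp: pp mv site_range[OF i, simplified] p)
      then show ?thesis unfolding pp F rho_coefs(2)[OF v' i p] by simp
    next
      case (K i)
      then have i: "i < n" using g by simp
      show ?thesis unfolding pp K rho_coefs(3)[OF v' i p] using zero b by (simp add: pp)
    next
      case (Ki i)
      then have i: "i < n" using g by simp
      show ?thesis unfolding pp Ki rho_coefs(4)[OF v' i p] using zero b by (simp add: pp)
    qed
  qed
qed

lemma W_tensor_supported: "W_tensor n l m \<subseteq> supported pairs"
  using level_states by (auto simp: W_tensor_eq supported_def)

lemma UA_module_W_tensor: "UA_module n \<epsilon> (W_tensor n l m) act"
proof -
  let ?M = "supported (level l \<times> level m) :: (state \<times> state \<Rightarrow>\<^sub>0 kfield) set"
  have M: "?M \<subseteq> supported pairs" using W_tensor_supported by (simp add: W_tensor_eq)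
  have "R a v \<in> ?M" if a: "a \<in> carrier A" and v: "v \<in> ?M" for a v
  proof (rule lin_maps_supported[OF lin_rho_param _ subspace_supported])
    show "a \<in> supported {w. \<forall>g\<in>set w. gen_index g < n}" using a by (simp add: in_free_algebra)
    show "R (Poly_Mapping.single w 1) v \<in> ?M" if "w \<in> {w. \<forall>g\<in>set w. gen_index g < n}" for w
      using that
    proof (induction w)
      case Nil
      then show ?case using rho_one[of v n \<epsilon> z z'] v M by (auto simp: single_list_one)
    next
      case (Cons g w)
      have "Poly_Mapping.single (g # w) 1 = gn g * Poly_Mapping.single w 1"
        by (simp add: gn_def mult_single plus_list_def)
      then show ?case using Cons by (simp add: rho_mult R_gn_level)
    qed
  qed
  then show ?thesis by (simp add: W_tensor_eq UA_module_iff[OF M] subspace_supported)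
qed

end

section \<open>Every nonzero submodule contains the vacuum\<close>

locale UA_submodule = UA_tensor n \<epsilon> x_par y_par for n \<epsilon> +
  fixes l m :: nat and S :: "(state \<times> state \<Rightarrow>\<^sub>0 kfield) set"
  assumes subspace_S: "pm.subspace S"
    and S_level: "S \<subseteq> supported (level l \<times> level m)"
    and E_closed: "\<And>i v. i < n \<Longrightarrow> v \<in> S \<Longrightarrow> R (gn (E i)) v \<in> S"
    and F_closed: "\<And>i v. i < n \<Longrightarrow> v \<in> S \<Longrightarrow> R (gn (F i)) v \<in> S"
begin

abbreviation cf where "cf v p p' \<equiv> Poly_Mapping.lookup v (p, p')"

lemma S_supported: "v \<in> S \<Longrightarrow> v \<in> supported pairs"
  using S_level level_states by (auto simp: supported_def)

lemma S_outside: "v \<in> S \<Longrightarrow> p \<notin> level l \<or> p' \<notin> level m \<Longrightarrow> cf v p p' = 0"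
  using S_level by (auto simp: supported_iff)

lemma S_outside': "v \<in> S \<Longrightarrow> p \<notin> states n \<or> p' \<notin> states n \<Longrightarrow> cf v p p' = 0"
  using S_outside level_states by blast

lemma E_coef:
  assumes "v \<in> supported pairs" "1 \<le> i" "i < n" "p \<in> states n" "p' \<in> states n"
  shows "cf (R (gn (E i)) v) p p' = qnum (p' i + 1) * cf v p (move (Suc i) i p')
    + qnum (p i + 1) * k_eigenvalue i p' * cf v (move (Suc i) i p) p'"
  using rho_coefs(1)[OF assms(1,3-5)] assms(2,3) by (simp add: source_eq target_eq)

lemma F_coef:
  assumes "v \<in> supported pairs" "1 \<le> i" "i < n" "p \<in> states n" "p' \<in> states n"
  shows "cf (R (gn (F i)) v) p p' = qnum (p (Suc i) + 1) * cf v (move i (Suc i) p) p'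
    + qnum (p' (Suc i) + 1) * inverse (k_eigenvalue i p) * cf v p (move i (Suc i) p')"
  using rho_coefs(2)[OF assms(1,3-5)] assms(2,3) by (simp add: source_eq target_eq)

lemma E0_coef:
  assumes "v \<in> supported pairs" "p \<in> states n" "p' \<in> states n"
  shows "cf (R (gn (E 0)) v) p p' = y_par * qnum (p' n + 1) * cf v p (move 1 n p')
    + x_par * qnum (p n + 1) * k_eigenvalue 0 p' * cf v (move 1 n p) p'"
  using rho_coefs(1)[OF assms(1) _ assms(2,3), of 0] n2 by (simp add: source_eq target_eq)

lemma F0_coef:
  assumes "v \<in> supported pairs" "p \<in> states n" "p' \<in> states n"
  shows "cf (R (gn (F 0)) v) p p' = inverse x_par * qnum (p 1 + 1) * cf v (move n 1 p) p'
    + inverse y_par * qnum (p' 1 + 1) * inverse (k_eigenvalue 0 p) * cf v p (move n 1 p')"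
  using rho_coefs(2)[OF assms(1) _ assms(2,3), of 0] n2 by (simp add: source_eq target_eq power_int_minus)

text \<open>The vectors of the submodule all of whose basis vectors have at least \<open>k\<close> bosons in total, that is,
  particles at the site \<open>n\<close> of either factor.\<close>

definition filt :: "nat \<Rightarrow> (state \<times> state \<Rightarrow>\<^sub>0 kfield) set" where
  "filt k = {v \<in> S. \<forall>p p'. cf v p p' \<noteq> 0 \<longrightarrow> int k \<le> p n + p' n}"

lemma filtD: "v \<in> filt k \<Longrightarrow> v \<in> S" "v \<in> filt k \<Longrightarrow> p n + p' n < int k \<Longrightarrow> cf v p p' = 0"
  by (force simp: filt_def)+

lemma filtI:
  assumes "v \<in> S" "\<And>p p'. p \<in> states n \<Longrightarrow> p' \<in> states n \<Longrightarrow> p n + p' n < int k \<Longrightarrow> cf v p p' = 0"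
  shows "v \<in> filt k"
  unfolding filt_def
proof (intro CollectI conjI allI impI assms(1))
  fix p p' assume nz: "cf v p p' \<noteq> 0"
  then have "p \<in> states n" "p' \<in> states n" using S_outside'[OF assms(1)] by blast+
  then show "int k \<le> p n + p' n" using assms(2) nz by force
qed

lemma filt_E: "v \<in> filt k \<Longrightarrow> 1 \<le> i \<Longrightarrow> Suc i < n \<Longrightarrow> R (gn (E i)) v \<in> filt k"
  by (rule filtI) (auto simp: E_closed filtD E_coef S_supported, auto simp: filtD move_def)

lemma filt_F: "v \<in> filt k \<Longrightarrow> 1 \<le> i \<Longrightarrow> Suc i < n \<Longrightarrow> R (gn (F i)) v \<in> filt k"
  by (rule filtI) (auto simp: F_closed filtD F_coef S_supported, auto simp: filtD move_def)

text \<open>The generators \<open>e\<^sub>n\<^sub>-\<^sub>1\<close> and \<open>f\<^sub>0\<close> turn a fermion into a boson.\<close>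

lemma filt_E_last: 
  assumes "v \<in> filt k"
  shows "R (gn (E (n - 1))) v \<in> filt (Suc k)"
proof (rule filtI)
  show "R (gn (E (n - 1))) v \<in> S" using assms n2 by (simp add: E_closed filtD)
  fix p p' assume "p \<in> states n" "p' \<in> states n" "p n + p' n < int (Suc k)"
  then show "cf (R (gn (E (n - 1))) v) p p' = 0"
  proof (subst E_coef)
    assume "p n + p' n < int (Suc k)"
    then have "cf v p (move n (n - 1) p') = 0" "cf v (move n (n - 1) p) p' = 0"
      using n2 by (auto intro!: filtD(2)[OF assms] simp: move_def)
    then show "qnum (p' (n - 1) + 1) * cf v p (move (Suc (n - 1)) (n - 1) p')
        + qnum (p (n - 1) + 1) * k_eigenvalue (n - 1) p' * cf v (move (Suc (n - 1)) (n - 1) p) p' = 0"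
      using n2 by simp
  qed (use n2 in \<open>simp_all add: S_supported filtD(1)[OF assms]\<close>)
qed

lemma filt_F0:
  assumes "v \<in> filt k"
  shows "R (gn (F 0)) v \<in> filt (Suc k)"
proof (rule filtI)
  show "R (gn (F 0)) v \<in> S" using assms n2 by (simp add: F_closed filtD)
  fix p p' assume "p \<in> states n" "p' \<in> states n" "p n + p' n < int (Suc k)"
  then show "cf (R (gn (F 0)) v) p p' = 0"
  proof (subst F0_coef)
    assume "p n + p' n < int (Suc k)"
    then have "cf v p (move n 1 p') = 0" "cf v (move n 1 p) p' = 0"
      using n2 by (auto intro!: filtD(2)[OF assms] simp: move_def)
    then show "inverse x_par * qnum (p 1 + 1) * cf v (move n 1 p) p'
        + inverse y_par * qnum (p' 1 + 1) * inverse (k_eigenvalue 0 p) * cf v p (move n 1 p') = 0"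
      by simp
  qed (use n2 in \<open>simp_all add: S_supported filtD(1)[OF assms]\<close>)
qed

text \<open>Only the coefficients of lowest boson number are controlled: they are the ones that \<open>e\<^sub>j\<close> and \<open>f\<^sub>j\<close>
  with \<open>1 \<le> j \<le> n-2\<close> mix among themselves.\<close>

definition bounded_on :: "nat \<Rightarrow> (state \<times> state \<Rightarrow>\<^sub>0 kfield) \<Rightarrow> bool" where
  "bounded_on k v \<longleftrightarrow> (\<forall>p p'. p n + p' n = int k \<longrightarrow> cf v p p' \<in> bounded_y)"

lemmas const_intros = consts_y_mult consts_y_inverse qnum_consts k_eigenvalue_consts x_par_consts

lemma bounded_E: 
  assumes v: "v \<in> S" "bounded_on k v" and i: "1 \<le> i" "Suc i < n"
  shows "bounded_on k (R (gn (E i)) v)"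
  unfolding bounded_on_def
proof (intro allI impI)
  fix p p' :: state assume k: "p n + p' n = int k"
  show "cf (R (gn (E i)) v) p p' \<in> bounded_y"
  proof (cases "p \<in> states n \<and> p' \<in> states n")
    case True
    have "cf v p (move (Suc i) i p') \<in> bounded_y" "cf v (move (Suc i) i p) p' \<in> bounded_y"
      using v(2) k i by (auto simp: bounded_on_def move_def)
    then show ?thesis
      using True i by (simp add: E_coef S_supported[OF v(1)] bounded_y_add const_bounded const_intros)
  next
    case False
    then have "cf (R (gn (E i)) v) p p' = 0" using S_outside'[OF E_closed[OF _ v(1)]] i by auto
    then show ?thesis by (simp add: zero_bounded)
  qed
qed

lemma bounded_F: 
  assumes v: "v \<in> S" "bounded_on k v" and i: "1 \<le> i" "Suc i < n"
  shows "bounded_on k (R (gn (F i)) v)"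
  unfolding bounded_on_def
proof (intro allI impI)
  fix p p' :: state assume k: "p n + p' n = int k"
  show "cf (R (gn (F i)) v) p p' \<in> bounded_y"
  proof (cases "p \<in> states n \<and> p' \<in> states n")
    case True
    have "cf v p (move i (Suc i) p') \<in> bounded_y" "cf v (move i (Suc i) p) p' \<in> bounded_y"
      using v(2) k i by (auto simp: bounded_on_def move_def)
    then show ?thesis
      using True i by (simp add: F_coef S_supported[OF v(1)] bounded_y_add const_bounded const_intros)
  next
    case False
    then have "cf (R (gn (F i)) v) p p' = 0" using S_outside'[OF F_closed[OF _ v(1)]] i by auto
    then show ?thesis by (simp add: zero_bounded)
  qed
qed

lemma occupied_move:
  assumes "p \<in> states n" "a \<in> {1..n}" "b \<in> {1..n}" "a \<noteq> b" "p a = 1" "b \<noteq> n \<Longrightarrow> p b = 0"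
  shows "move a b p \<in> states n"
  using assms by (simp add: move_in_states_iff)

context
  fixes k
  assumes top: "filt (Suc k) = {0}"
begin

text \<open>For \<open>j = 1\<close> the relation \<open>f\<^sub>0v = 0\<close> expresses the coefficient through one that carries the small
  factor \<open>y\<^sup>-\<^sup>1\<close>. For the step, \<open>f\<^sub>j\<close> moves the fermion from \<open>j+1\<close> to \<open>j\<close>; at basis vectors with a
  fermion at \<open>j\<close>, the coefficients of both \<open>f\<^sub>jv\<close> and \<open>v\<close> are small by induction, and the remaining
  summand of the coefficient of \<open>f\<^sub>jv\<close> is the coefficient of \<open>v\<close> in question.\<close>

lemma first_factor_small:
  assumes "1 \<le> j" "j < n"
  shows "v \<in> filt k \<Longrightarrow> bounded_on k v \<Longrightarrow> p \<in> states n \<Longrightarrow> p' \<in> states n \<Longrightarrow>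
    p n + p' n = int k \<Longrightarrow> p j = 1 \<Longrightarrow> cf v p p' \<in> small_y"
  using assms
proof (induction j arbitrary: v p p' rule: nat_induct_at_least)
  case base
  have v: "v \<in> supported pairs" using base.prems by (simp add: filtD S_supported)
  define r where "r = move 1 n p"
  have r: "r \<in> states n" "move n 1 r = p" "r 1 = 0" "r n = p n + 1"
    unfolding r_def using base.prems n2 by (auto intro!: occupied_move) (auto simp: move_def)
  have "R (gn (F 0)) v = 0" using filt_F0[OF base.prems(1)] top by simp
  then have "0 = cf (R (gn (F 0)) v) r p'" by simp
  also have "\<dots> = inverse x_par * cf v p p'
      + inverse y_par * (qnum (p' 1 + 1) * inverse (k_eigenvalue 0 r) * cf v r (move n 1 p'))"
    using F0_coef[OF v r(1) base.prems(4)] r by (simp add: mult.assoc)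
  finally have "cf v p p' = - (x_par * (inverse y_par * (qnum (p' 1 + 1) * inverse (k_eigenvalue 0 r) * cf v r (move n 1 p'))))"
    using x_par_nonzero by (simp add: field_simps eq_neg_iff_add_eq_0)
  moreover have "cf v r (move n 1 p') \<in> bounded_y"
    using base.prems(2,5) r(4) n2 by (simp add: bounded_on_def move_def)
  then have "qnum (p' 1 + 1) * inverse (k_eigenvalue 0 r) * cf v r (move n 1 p') \<in> bounded_y"
    by (rule const_bounded[rotated]) (intro const_intros)
  from bounded_small_mult[OF this inverse_y_par_small]
  have "x_par * (inverse y_par * (qnum (p' 1 + 1) * inverse (k_eigenvalue 0 r) * cf v r (move n 1 p'))) \<in> small_y"
    by (intro const_small[OF x_par_consts]) (simp add: mult_ac)
  ultimately show ?case by (simp add: small_y_uminus)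
next
  case (Suc j)
  note j = \<open>1 \<le> j\<close> \<open>Suc j < n\<close>
  have v: "v \<in> supported pairs" "v \<in> S" using Suc.prems by (simp_all add: filtD S_supported)
  have IH: "cf w r r' \<in> small_y" if "w \<in> filt k" "bounded_on k w" "r n + r' n = int k" "r j = 1" for w r r'
  proof (cases "r \<in> states n \<and> r' \<in> states n")
    case True then show ?thesis using Suc.IH that j by auto
  next
    case False then show ?thesis using S_outside'[OF filtD(1)[OF that(1)]] by auto
  qed
  show ?case
  proof (cases "p j = 0")
    case False
    then have "p j = 1" using occupation_cases[OF Suc.prems(3), of j] j by auto
    then show ?thesis using IH Suc.prems by blast
  next
    case True
    define r where "r = move (Suc j) j p"
    have r: "r \<in> states n" "move j (Suc j) r = p" "r j = 1" "r (Suc j) = 0" "r n = p n"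
      unfolding r_def using Suc.prems True j by (auto intro!: occupied_move) (auto simp: move_def)
    have "cf (R (gn (F j)) v) r p' = cf v p p'
        + qnum (p' (Suc j) + 1) * inverse (k_eigenvalue j r) * cf v r (move j (Suc j) p')"
      using F_coef[OF v(1) j(1) _ r(1) Suc.prems(4)] j r by simp
    moreover have "cf (R (gn (F j)) v) r p' \<in> small_y"
      using Suc.prems r by (intro IH filt_F bounded_F v j) auto
    moreover have "cf v r (move j (Suc j) p') \<in> small_y"
      using Suc.prems r j by (intro IH) (auto simp: move_def)
    then have "qnum (p' (Suc j) + 1) * inverse (k_eigenvalue j r) * cf v r (move j (Suc j) p') \<in> small_y"
      by (rule const_small[rotated]) (intro const_intros)
    ultimately show ?thesis by (metis add_diff_cancel_right' small_y_diff)
  qed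
qed

text \<open>Here \<open>e\<^sub>n\<^sub>-\<^sub>1v = 0\<close> starts the induction at site \<open>n-1\<close>. It carries no small factor; instead, the
  competing coefficient has a fermion in the first factor and is small by the previous lemma.\<close>

lemma second_factor_small:
  assumes "1 \<le> j" "j < n"
  shows "v \<in> filt k \<Longrightarrow> bounded_on k v \<Longrightarrow> p \<in> states n \<Longrightarrow> p' \<in> states n \<Longrightarrow>
    p n + p' n = int k \<Longrightarrow> p' j = 1 \<Longrightarrow> cf v p p' \<in> small_y"
proof -
  have j: "j \<le> n - 1" using assms by simp
  from j show "v \<in> filt k \<Longrightarrow> bounded_on k v \<Longrightarrow> p \<in> states n \<Longrightarrow> p' \<in> states n \<Longrightarrow>
    p n + p' n = int k \<Longrightarrow> p' j = 1 \<Longrightarrow> cf v p p' \<in> small_y"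
  proof (induction j arbitrary: v p p' rule: inc_induct)
    case base
    define j where "j = n - 1"
    have j: "1 \<le> j" "j < n" "Suc j = n" using n2 by (auto simp: j_def)
    have v: "v \<in> supported pairs" "v \<in> S" using base.prems by (simp_all add: filtD S_supported)
    define r where "r = move j n p'"
    have r: "r \<in> states n" "move n j r = p'" "r j = 0" "r n = p' n + 1"
      unfolding r_def using base.prems j by (auto intro!: occupied_move simp: j_def) (auto simp: move_def)
    have "R (gn (E j)) v = 0" using filt_E_last[OF base.prems(1)] top by (simp add: j_def)
    then have "0 = cf (R (gn (E j)) v) p r" by simp
    also have "\<dots> = cf v p p' + qnum (p j + 1) * k_eigenvalue j r * cf v (move n j p) r"
      using E_coef[OF v(1) j(1,2) base.prems(3) r(1)] j r by simp
    finally have "cf v p p' = - (qnum (p j + 1) * k_eigenvalue j r * cf v (move n j p) r)"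
      by (simp add: eq_neg_iff_add_eq_0)
    moreover have "cf v (move n j p) r \<in> small_y"
    proof (cases "move n j p \<in> states n")
      case True
      then have "move n j p j = 1"
        using base.prems(3) j by (auto simp: move_in_states_iff) (auto simp: move_def)
      then show ?thesis
        using first_factor_small[OF j(1,2) base.prems(1,2) True r(1)] base.prems r j by (simp add: move_def)
    next
      case False then show ?thesis by (simp add: S_outside'[OF v(2)])
    qed
    then have "qnum (p j + 1) * k_eigenvalue j r * cf v (move n j p) r \<in> small_y"
      by (rule const_small[rotated]) (intro const_intros)
    ultimately show ?case by (simp add: small_y_uminus)
  next
    case (step j)
    have j: "1 \<le> j" "Suc j < n" using step assms(1) by auto
    have v: "v \<in> supported pairs" "v \<in> S" using step.prems by (simp_all add: filtD S_supported)
    have IH: "cf w r r' \<in> small_y" if "w \<in> filt k" "bounded_on k w" "r n + r' n = int k" "r' (Suc j) = 1" for w r r'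
    proof (cases "r \<in> states n \<and> r' \<in> states n")
      case True then show ?thesis using step.IH that j by auto
    next
      case False then show ?thesis using S_outside'[OF filtD(1)[OF that(1)]] by auto
    qed
    show ?case
    proof (cases "p' (Suc j) = 0")
      case False
      then have "p' (Suc j) = 1" using occupation_cases[OF step.prems(4), of "Suc j"] j by auto
      then show ?thesis using IH step.prems by blast
    next
      case True
      define r where "r = move j (Suc j) p'"
      have r: "r \<in> states n" "move (Suc j) j r = p'" "r (Suc j) = 1" "r j = 0" "r n = p' n"
        unfolding r_def using step.prems True j by (auto intro!: occupied_move) (auto simp: move_def)
      have "cf (R (gn (E j)) v) p r = cf v p p' + qnum (p j + 1) * k_eigenvalue j r * cf v (move (Suc j) j p) r"
        using E_coef[OF v(1) j(1) _ step.prems(3) r(1)] j r by simp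
      moreover have "cf (R (gn (E j)) v) p r \<in> small_y"
        using step.prems r by (intro IH filt_E bounded_E v j) auto
      moreover have "cf v (move (Suc j) j p) r \<in> small_y"
        using step.prems r j by (intro IH) (auto simp: move_def)
      then have "qnum (p j + 1) * k_eigenvalue j r * cf v (move (Suc j) j p) r \<in> small_y"
        by (rule const_small[rotated]) (intro const_intros)
      ultimately show ?thesis by (metis add_diff_cancel_right' small_y_diff)
    qed
  qed
qed

end

abbreviation Omega where "Omega \<equiv> (vac l, vac m)"

lemma vacuum_in_submodule:
  assumes "S \<noteq> {0}"
  shows "Poly_Mapping.single Omega 1 \<in> S"
proof -
  have zero: "0 \<in> S" using pm.subspace_0[OF subspace_S] .
  obtain v0 where v0: "v0 \<in> S" "v0 \<noteq> 0" using assms zero by blast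
  have level: "p \<in> level l" "p' \<in> level m" if "v \<in> S" "cf v p p' \<noteq> 0" for v p p'
    using S_outside that by blast+
  have key: "\<exists>p p'. cf v p p' \<noteq> 0" if "v \<noteq> 0" for v :: "state \<times> state \<Rightarrow>\<^sub>0 kfield"
    using tens_eqI[of v 0] that by auto
  have P0: "v0 \<in> filt 0"
  proof (rule filtI[OF v0(1)])
    fix p p' :: state assume "p \<in> states n" "p' \<in> states n" "p n + p' n < int 0"
    moreover then have "0 \<le> p n" "0 \<le> p' n" by (auto simp: states_iff)
    ultimately show "cf v0 p p' = 0" by simp
  qed
  have bound: "k \<le> l + m" if "v \<in> filt k" "v \<noteq> 0" for k v
  proof -
    from key[OF that(2)] obtain p p' where pp: "cf v p p' \<noteq> 0" by blast
    then have "int k \<le> p n + p' n" using that(1) by (force simp: filt_def)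
    then show ?thesis
      using level_boson_le[OF level(1)[OF filtD(1)[OF that(1)] pp]]
        level_boson_le[OF level(2)[OF filtD(1)[OF that(1)] pp]] by linarith
  qed
  obtain k where k: "\<exists>v\<in>filt k. v \<noteq> 0" and max: "\<And>k'. \<exists>v\<in>filt k'. v \<noteq> 0 \<Longrightarrow> k' \<le> k"
    using Nat.ex_has_greatest_nat[of "\<lambda>k. \<exists>v\<in>filt k. v \<noteq> 0" 0 "l + m"] v0 P0 bound by blast
  have "0 \<in> filt (Suc k)" using zero by (simp add: filt_def)
  then have top: "filt (Suc k) = {0}" using max[of "Suc k"] by auto
  obtain v where v: "v \<in> filt k" "v \<noteq> 0" using k by blast
  have vS: "v \<in> S" using v by (simp add: filtD)
  \<comment> \<open>The coefficients of lowest boson number, one of which dominates the others.\<close>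
  define D where "D = Poly_Mapping.lookup v ` {b \<in> Poly_Mapping.keys v. fst b n + snd b n = int k}"
  have "v \<notin> filt (Suc k)" using top v by simp
  then obtain p p' where "cf v p p' \<noteq> 0" "p n + p' n < int (Suc k)" 
    using filtI[OF vS] by blast
  moreover then have "int k \<le> p n + p' n" using v(1) by (force simp: filt_def)
  ultimately have "(p, p') \<in> Poly_Mapping.keys v" "p n + p' n = int k" by (auto simp: in_keys_iff)
  then have "D \<noteq> {}" by (auto simp: D_def)
  moreover have "finite D" "0 \<notin> D" by (auto simp: D_def in_keys_iff)
  ultimately have "\<exists>u\<in>D. \<forall>c\<in>D. c / u \<in> bounded_y" by (intro finite_bounded_by_member)
  then obtain u where u: "u \<in> D" "\<And>c. c \<in> D \<Longrightarrow> c / u \<in> bounded_y" by auto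
  have u0: "u \<noteq> 0" using u(1) \<open>0 \<notin> D\<close> by metis
  obtain q q' where q: "cf v q q' = u" "q n + q' n = int k"
    using u(1) by (auto simp: D_def)
  define w where "w = inverse u *\<^sub>K v"
  have w: "w \<in> filt k" using v pm.subspace_scale[OF subspace_S] by (auto simp: filt_def w_def lookup_smul)
  have bw: "bounded_on k w"
    unfolding bounded_on_def
  proof (intro allI impI)
    fix r r' :: state assume r: "r n + r' n = int k"
    have w_eq: "cf w r r' = cf v r r' / u" by (simp add: w_def lookup_smul divide_inverse mult.commute)
    show "cf w r r' \<in> bounded_y"
    proof (cases "cf v r r' = 0")
      case True then show ?thesis by (simp add: w_eq zero_bounded)
    next
      case False
      then have "cf v r r' \<in> D"
        unfolding D_def using r by (intro image_eqI[of _ _ "(r, r')"]) (simp_all add: in_keys_iff)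
      then show ?thesis by (simp add: w_eq u(2))
    qed
  qed
  have not_small: "cf w q q' \<notin> small_y"
    using u0 q one_not_small_y by (simp add: w_def lookup_smul)
  have lev: "q \<in> level l" "q' \<in> level m" using level[OF vS, of q q'] q u0 by simp_all
  note st = level_states[OF lev(1)] level_states[OF lev(2)]
  \<comment> \<open>The position of the dominating coefficient can only be the vacuum.\<close>
  have "q j \<noteq> 1" "q' j \<noteq> 1" if "1 \<le> j" "j < n" for j
    using first_factor_small[OF top that w bw st q(2)] second_factor_small[OF top that w bw st q(2)]
      not_small by metis+
  then have "q j = 0" "q' j = 0" if "1 \<le> j" "j < n" for j
    using that occupation_cases[OF st(1), of j] occupation_cases[OF st(2), of j] by (metis less_irrefl)+
  then have "q = vac l" "q' = vac m" using level_vacI lev by blast+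
  then have k_eq: "int k = int l + int m" using q by (simp add: vac_def)
  have "r = vac l \<and> r' = vac m" if "cf v r r' \<noteq> 0" for r r'
  proof -
    have r: "r \<in> level l" "r' \<in> level m" using level[OF vS that] by blast+
    moreover have "int k \<le> r n + r' n" using that v(1) by (force simp: filt_def)
    ultimately have "r n = int l" "r' n = int m" using k_eq level_boson_le[of r l] level_boson_le[of r' m] by auto
    then show ?thesis using r level_boson_eq by blast
  qed
  then have "v = cf v (vac l) (vac m) *\<^sub>K Poly_Mapping.single Omega 1"
    by (intro tens_eqI) (auto simp: lookup_smul lookup_single when_def)
  moreover have "cf v (vac l) (vac m) \<noteq> 0" using q u0 \<open>q = vac l\<close> \<open>q' = vac m\<close> by simp
  ultimately have "Poly_Mapping.single Omega 1 = inverse (cf v (vac l) (vac m)) *\<^sub>K v"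
    by (metis left_inverse pm.scale_one pm.scale_scale)
  then show ?thesis using pm.subspace_scale[OF subspace_S vS] by simp
qed

end

section \<open>The vacuum generates\<close>

text \<open>Nakayama's lemma, proved by Gaussian elimination: the pivot differs from \<open>1\<close> by a small element,
  so it is invertible in the valuation ring, and clearing its column keeps the other vectors
  approximations of their basis vectors.\<close>

lemma supported_subset_of_approximate_basis:
  fixes S :: "('a \<Rightarrow>\<^sub>0 'k::idom poly fract) set"
  assumes "finite B" "pm.subspace S"
    and "\<And>b. b \<in> B \<Longrightarrow> \<exists>s\<in>S \<inter> supported B. \<forall>c. Poly_Mapping.lookup s c - (1 when c = b) \<in> small_y"
  shows "supported B \<subseteq> S"
  using assms(1,3)
proof (induction B rule: finite_induct)
  case empty
  have "v = 0" if "v \<in> supported {}" for v :: "'a \<Rightarrow>\<^sub>0 'k poly fract"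
    using that by (intro poly_mapping_eqI) (simp add: supported_iff)
  then show ?case using pm.subspace_0[OF assms(2)] by auto
next
  case (insert b0 B)
  obtain s0 where s0: "s0 \<in> S" "s0 \<in> supported (insert b0 B)"
    "\<And>c. Poly_Mapping.lookup s0 c - (1 when c = b0) \<in> small_y"
    using insert.prems[of b0] by auto
  define u where "u = Poly_Mapping.lookup s0 b0"
  have "u - 1 \<in> small_y" using s0(3)[of b0] by (simp add: u_def)
  then have u: "u \<noteq> 0" "inverse u \<in> bounded_y" by (rule unit_of_small_perturbation)+
  define elim where "elim v = v - (Poly_Mapping.lookup v b0 * inverse u) *\<^sub>K s0" for v
  have elim_supported: "elim v \<in> supported B" if "v \<in> supported (insert b0 B)" for v
    unfolding supported_iff
  proof (intro allI impI)
    fix c assume "c \<notin> B"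
    then show "Poly_Mapping.lookup (elim v) c = 0"
      using u that s0(2) by (cases "c = b0") (auto simp: elim_def lookup_minus lookup_smul u_def supported_iff)
  qed
  have "supported B \<subseteq> S"
  proof (rule insert.IH)
    fix b assume b: "b \<in> B"
    obtain s where s: "s \<in> S" "s \<in> supported (insert b0 B)"
      "\<And>c. Poly_Mapping.lookup s c - (1 when c = b) \<in> small_y"
      using insert.prems[of b] b by auto
    have "b0 \<noteq> b" using insert.hyps b by auto
    then have sb0: "Poly_Mapping.lookup s b0 \<in> small_y" using s(3)[of b0] by simp
    have "Poly_Mapping.lookup (elim s) c - (1 when c = b) \<in> small_y" for c
    proof (cases "c = b0")
      case True
      then show ?thesis using u \<open>b0 \<noteq> b\<close> by (simp add: elim_def lookup_minus lookup_smul u_def mult.assoc)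
    next
      case False
      then have "Poly_Mapping.lookup s0 c \<in> small_y" using s0(3)[of c] by simp
      then have "(Poly_Mapping.lookup s b0 * inverse u) * Poly_Mapping.lookup s0 c \<in> small_y"
        by (intro bounded_small_mult bounded_y_mult u small_y_bounded[OF sb0])
      from small_y_diff[OF s(3)[of c] this] show ?thesis
        by (simp add: elim_def lookup_minus lookup_smul algebra_simps)
    qed
    moreover have "elim s \<in> S"
      unfolding elim_def by (intro pm.subspace_diff pm.subspace_scale assms(2) s0 s)
    ultimately show "\<exists>s\<in>S \<inter> supported B. \<forall>c. Poly_Mapping.lookup s c - (1 when c = b) \<in> small_y"
      using elim_supported[OF s(2)] by blast
  qed
  then show ?case
  proof (intro subsetI)
    fix v :: "'a \<Rightarrow>\<^sub>0 'k poly fract" assume B: "supported B \<subseteq> S" and v: "v \<in> supported (insert b0 B)"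
    have "v = elim v + (Poly_Mapping.lookup v b0 * inverse u) *\<^sub>K s0" by (simp add: elim_def)
    moreover have "elim v \<in> S" using B elim_supported[OF v] by blast
    ultimately show "v \<in> S" by (metis pm.subspace_add pm.subspace_scale assms(2) s0(1))
  qed
qed

context UA_rep
begin

lemma move_in_level:
  assumes "p \<in> level l" "a \<in> {1..n}" "b \<in> {1..n}" "a \<noteq> b" "p a = 1" "b \<noteq> n \<Longrightarrow> p b = 0"
  shows "move a b p \<in> level l"
  using assms level_states[of p l] by (subst move_level_iff) (auto simp: move_in_states_iff)

lemma level_weight_nonneg: 
  assumes "p \<in> level l" "\<And>i. 0 \<le> w i"
  shows "0 \<le> (\<Sum>i=1..n. w i * p i)"
  using assms level_states[of p l] by (intro sum_nonneg mult_nonneg_nonneg) (auto simp: states_iff)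

text \<open>Every state arises from the vacuum by creating fermions at site \<open>1\<close> and shifting them to the right.
  The predecessor of a state is found by undoing the last step on its leftmost fermion, which decreases
  the sum of the positions of the fermions.\<close>

lemma level_induct_ascending [consumes 1, case_names vac create shift]:
  assumes p: "p \<in> level l"
    and vac: "P (vac l)"
    and create: "\<And>p. p \<in> level l \<Longrightarrow> P p \<Longrightarrow> 1 \<le> p n \<Longrightarrow> p 1 = 0 \<Longrightarrow> move n 1 p \<in> level l \<Longrightarrow> P (move n 1 p)"
    and shift: "\<And>p j. p \<in> level l \<Longrightarrow> P p \<Longrightarrow> 1 \<le> j \<Longrightarrow> Suc j < n \<Longrightarrow> p j = 1 \<Longrightarrow> p (Suc j) = 0 \<Longrightarrow>
      move j (Suc j) p \<in> level l \<Longrightarrow> P (move j (Suc j) p)"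
  shows "P p"
  using p
proof (induction "nat (\<Sum>i=1..n. (if i = n then 0 else int i) * p i)" arbitrary: p rule: less_induct)
  case less
  let ?w = "\<lambda>i. if i = n then 0 else int i"
  let ?W = "\<lambda>p. \<Sum>i=1..n. ?w i * p i"
  have nn: "0 \<le> ?w i" for i by simp
  have IH: "P (move a b p)" if "move a b p \<in> level l" "a \<in> {1..n}" "b \<in> {1..n}" "?w b < ?w a" for a b
    using level_weight_nonneg[where w = ?w, OF that(1) nn] level_weight_nonneg[where w = ?w, OF less.prems nn]
      weight_move[OF that(2,3), of ?w p] that(4) by (intro less.hyps that(1)) auto
  show ?case
  proof (cases "\<exists>j. 1 \<le> j \<and> j < n \<and> p j = 1")
    case False
    have "p i = 0" if "1 \<le> i" "i < n" for i
      using False that occupation_cases[OF level_states[OF less.prems], of i] by (metis less_irrefl)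
    then have "p = vac l" by (rule level_vacI[OF less.prems])
    then show ?thesis using vac by simp
  next
    case True
    define j where "j = (LEAST j. 1 \<le> j \<and> j < n \<and> p j = 1)"
    have j: "1 \<le> j" "j < n" "p j = 1" using LeastI_ex[OF True] by (simp_all add: j_def)
    have least: "p i = 0" if "1 \<le> i" "i < j" for i
      using not_less_Least[of i "\<lambda>j. 1 \<le> j \<and> j < n \<and> p j = 1"] that j
        occupation_cases[OF level_states[OF less.prems], of i] by (auto simp: j_def)
    show ?thesis
    proof (cases "j = 1")
      case True
      let ?r = "move 1 n p"
      have r: "?r \<in> level l" using n2 j True by (intro move_in_level less.prems) auto
      moreover have "0 \<le> p n" using level_states[OF less.prems] by (simp add: states_iff)
      then have "1 \<le> ?r n" "?r 1 = 0" using n2 j True by (simp_all add: move_def)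
      moreover have "P ?r" using r n2 by (intro IH) auto
      ultimately have "P (move n 1 ?r)" using less.prems by (intro create) simp_all
      then show ?thesis by simp
    next
      case False
      then obtain i where i: "j = Suc i" "1 \<le> i" using j by (cases j) auto
      let ?r = "move (Suc i) i p"
      have r: "?r \<in> level l" using j i least by (intro move_in_level less.prems) auto
      moreover have "?r i = 1" "?r (Suc i) = 0" using j i least by (simp_all add: move_def)
      moreover have "P ?r" using r j i by (intro IH) auto
      ultimately have "P (move i (Suc i) ?r)" using less.prems i j by (intro shift) simp_all
      then show ?thesis by simp
    qed
  qed
qed

text \<open>Every state arises from the vacuum by creating fermions at site \<open>n-1\<close> and shifting them to the left.
  Since \<open>f\<^sub>n\<^sub>-\<^sub>1\<close> acts for the creation and \<open>f\<^sub>j\<close> for the shifts, one rule covers both. The predecessor is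
  found from the rightmost fermion.\<close>

lemma level_induct_descending [consumes 1, case_names vac shift]:
  assumes p: "p \<in> level l"
    and vac: "P (vac l)"
    and shift: "\<And>p j. p \<in> level l \<Longrightarrow> P p \<Longrightarrow> 1 \<le> j \<Longrightarrow> j < n \<Longrightarrow> p j = 0 \<Longrightarrow> 1 \<le> p (Suc j) \<Longrightarrow>
      move (Suc j) j p \<in> level l \<Longrightarrow> P (move (Suc j) j p)"
  shows "P p"
  using p
proof (induction "nat (\<Sum>i=1..n. int (n - i) * p i)" arbitrary: p rule: less_induct)
  case less
  let ?w = "\<lambda>i. int (n - i)"
  have nn: "0 \<le> ?w i" for i by simp
  have IH: "P (move a b p)" if "move a b p \<in> level l" "a \<in> {1..n}" "b \<in> {1..n}" "?w b < ?w a" for a b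
    using level_weight_nonneg[where w = ?w, OF that(1) nn] level_weight_nonneg[where w = ?w, OF less.prems nn]
      weight_move[OF that(2,3), of ?w p] that(4) by (intro less.hyps that(1)) auto
  show ?case
  proof (cases "\<exists>j. 1 \<le> j \<and> j < n \<and> p j = 1")
    case False
    have "p i = 0" if "1 \<le> i" "i < n" for i
      using False that occupation_cases[OF level_states[OF less.prems], of i] by (metis less_irrefl)
    then have "p = vac l" by (rule level_vacI[OF less.prems])
    then show ?thesis using vac by simp
  next
    case True
    define j where "j = Max {j. 1 \<le> j \<and> j < n \<and> p j = 1}"
    have fin: "finite {j. 1 \<le> j \<and> j < n \<and> p j = 1}" by (rule finite_subset[of _ "{..<n}"]) auto
    have "j \<in> {j. 1 \<le> j \<and> j < n \<and> p j = 1}" unfolding j_def using True by (intro Max_in fin) auto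
    then have j: "1 \<le> j" "j < n" "p j = 1" by auto
    have greatest: "p i = 0" if "j < i" "i < n" for i
    proof (rule ccontr)
      assume "p i \<noteq> 0"
      then have "p i = 1" using occupation_cases[OF level_states[OF less.prems], of i] that by auto
      then have "i \<le> j" unfolding j_def using that j by (intro Max_ge[OF fin]) auto
      then show False using that by simp
    qed
    let ?r = "move j (Suc j) p"
    have r: "?r \<in> level l" using j greatest by (intro move_in_level less.prems) auto
    have "0 \<le> p (Suc j)" using level_states[OF less.prems] by (simp add: states_iff)
    then have "?r j = 0" "1 \<le> ?r (Suc j)" using j by (simp_all add: move_def)
    moreover have "P ?r" using r j by (intro IH) auto
    ultimately have "P (move (Suc j) j ?r)" using r less.prems j by (intro shift) simp_all
    then show ?thesis by simp
  qed
qed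

end

context UA_submodule
begin

text \<open>Congruence modulo small coefficients to an element of the submodule. The vectors themselves may have
  unbounded coefficients.\<close>

definition approx :: "(state \<times> state \<Rightarrow>\<^sub>0 kfield) set" where
  "approx = {w \<in> supported pairs. \<exists>s\<in>S. \<forall>p p'. cf s p p' - cf w p p' \<in> small_y}"

abbreviation kets where "kets p p' \<equiv> tens (ket n p) (ket n p')"

lemma kets_supported: "kets p p' \<in> supported pairs"
  by (intro tens_in_supported ket_in_supported)

lemma approxI:
  assumes "s \<in> S" "w \<in> supported pairs" "\<And>p p'. cf s p p' - cf w p p' \<in> small_y"
  shows "w \<in> approx"
  using assms by (auto simp: approx_def)

lemma approx_diff: 
  assumes "v \<in> approx" "w \<in> approx"
  shows "v - w \<in> approx"
proof -
  obtain s t where st: "s \<in> S" "\<And>p p'. cf s p p' - cf v p p' \<in> small_y"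
     "t \<in> S" "\<And>p p'. cf t p p' - cf w p p' \<in> small_y" using assms by (auto simp: approx_def)
  show ?thesis
  proof (rule approxI)
    show "s - t \<in> S" using st by (intro pm.subspace_diff subspace_S)
    show "v - w \<in> supported pairs"
      using assms by (intro pm.subspace_diff subspace_supported) (auto simp: approx_def)
    fix p p'
    show "cf (s - t) p p' - cf (v - w) p p' \<in> small_y"
      using small_y_diff[OF st(2) st(4), of p p' p p'] by (simp add: lookup_minus algebra_simps)
  qed
qed

lemma approx_scale:
  assumes "v \<in> approx" "c \<in> consts_y"
  shows "c *\<^sub>K v \<in> approx"
proof -
  obtain s where s: "s \<in> S" "\<And>p p'. cf s p p' - cf v p p' \<in> small_y"
    using assms by (auto simp: approx_def)
  show ?thesis
  proof (rule approxI)
    show "c *\<^sub>K s \<in> S" using s by (intro pm.subspace_scale subspace_S)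
    show "c *\<^sub>K v \<in> supported pairs"
      using assms by (intro pm.subspace_scale subspace_supported) (auto simp: approx_def)
    fix p p'
    show "cf (c *\<^sub>K s) p p' - cf (c *\<^sub>K v) p p' \<in> small_y"
      using const_small[OF assms(2) s(2)[of p p']] by (simp add: lookup_smul algebra_simps)
  qed
qed

lemma approx_unscale:
  assumes "c *\<^sub>K v \<in> approx" "c \<in> consts_y" "c \<noteq> 0"
  shows "v \<in> approx"
  using approx_scale[OF assms(1) consts_y_inverse[OF assms(2)]] assms(3) by simp

lemma approx_perturb:
  assumes "v \<in> approx" "w \<in> supported pairs" "\<And>p p'. cf v p p' - cf w p p' \<in> small_y"
  shows "w \<in> approx"
proof -
  obtain s where s: "s \<in> S" "\<And>p p'. cf s p p' - cf v p p' \<in> small_y"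
    using assms by (auto simp: approx_def)
  show ?thesis
  proof (rule approxI[OF s(1) assms(2)])
    fix p p'
    show "cf s p p' - cf w p p' \<in> small_y"
      using small_y_add[OF s(2)[of p p'] assms(3)[of p p']] by simp
  qed
qed

text \<open>An operator preserves approximability as soon as it maps errors to errors.\<close>

lemma approx_operator:
  assumes v: "v \<in> approx" and f: "lin f" "\<And>s. s \<in> S \<Longrightarrow> f s \<in> S" "\<And>w. f w \<in> supported pairs"
    and small: "\<And>w p p'. w \<in> supported pairs \<Longrightarrow> (\<And>p p'. cf w p p' \<in> small_y) \<Longrightarrow>
      p \<in> states n \<Longrightarrow> p' \<in> states n \<Longrightarrow> cf (f w) p p' \<in> small_y"
  shows "f v \<in> approx"
proof -
  obtain s where s: "s \<in> S" "\<And>p p'. cf s p p' - cf v p p' \<in> small_y"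
    using v by (auto simp: approx_def)
  show ?thesis
  proof (rule approxI)
    show "f s \<in> S" "f v \<in> supported pairs" using s f by auto
    fix p p'
    have sv: "s - v \<in> supported pairs"
      using v S_supported[OF s(1)] by (intro pm.subspace_diff subspace_supported) (auto simp: approx_def)
    have "cf (f (s - v)) p p' \<in> small_y"
    proof (cases "p \<in> states n \<and> p' \<in> states n")
      case True then show ?thesis using small[OF sv] s(2) by (simp add: lookup_minus)
    next
      case False
      then have "cf (f (s - v)) p p' = 0" using f(3)[of "s - v"] by (auto simp: supported_iff)
      then show ?thesis by simp
    qed
    then show "cf (f s) p p' - cf (f v) p p' \<in> small_y" by (simp add: lin_diff[OF f(1)] lookup_minus)
  qed
qed

lemma approx_E:
  assumes "v \<in> approx" "1 \<le> i" "i < n"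
  shows "R (gn (E i)) v \<in> approx"
proof (rule approx_operator[OF assms(1) lin_rho])
  fix w :: "state \<times> state \<Rightarrow>\<^sub>0 kfield" and p p' assume "w \<in> supported pairs" "\<And>p p'. cf w p p' \<in> small_y" "p \<in> states n" "p' \<in> states n"
  then show "cf (R (gn (E i)) w) p p' \<in> small_y"
    using assms(2,3) by (simp add: E_coef small_y_add const_small const_intros)
qed (use assms in \<open>auto simp: E_closed R_in_supported\<close>)

lemma approx_F:
  assumes "v \<in> approx" "1 \<le> i" "i < n"
  shows "R (gn (F i)) v \<in> approx"
proof (rule approx_operator[OF assms(1) lin_rho])
  fix w :: "state \<times> state \<Rightarrow>\<^sub>0 kfield" and p p' assume "w \<in> supported pairs" "\<And>p p'. cf w p p' \<in> small_y" "p \<in> states n" "p' \<in> states n"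
  then show "cf (R (gn (F i)) w) p p' \<in> small_y"
    using assms(2,3) by (simp add: F_coef small_y_add const_small const_intros)
qed (use assms in \<open>auto simp: F_closed R_in_supported\<close>)

text \<open>Division by \<open>y\<close> makes the matrix coefficients of \<open>e\<^sub>0\<close> bounded, and small on the first factor.\<close>

lemma approx_E0:
  assumes "v \<in> approx"
  shows "inverse y_par *\<^sub>K R (gn (E 0)) v \<in> approx"
proof (rule approx_operator[OF assms(1)])
  show "lin (\<lambda>v. inverse y_par *\<^sub>K R (gn (E 0)) v)"
    by (rule linI) (simp_all add: lin_add[OF lin_rho] lin_smul[OF lin_rho] pm.scale_right_distrib mult.commute)
  show "inverse y_par *\<^sub>K R (gn (E 0)) s \<in> S" if "s \<in> S" for s
    using that n2 by (intro pm.subspace_scale subspace_S E_closed) auto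
  show "inverse y_par *\<^sub>K R (gn (E 0)) w \<in> supported pairs" for w
    by (intro pm.subspace_scale subspace_supported R_in_supported)
  fix w :: "state \<times> state \<Rightarrow>\<^sub>0 kfield" and p p' assume w: "w \<in> supported pairs" "\<And>p p'. cf w p p' \<in> small_y" "p \<in> states n" "p' \<in> states n"
  have "cf (inverse y_par *\<^sub>K R (gn (E 0)) w) p p' = qnum (p' n + 1) * cf w p (move 1 n p')
      + inverse y_par * (x_par * qnum (p n + 1) * k_eigenvalue 0 p' * cf w (move 1 n p) p')"
    using y_par_nonzero by (simp add: lookup_smul E0_coef[OF w(1,3,4)] field_simps)
  also have "\<dots> \<in> small_y"
    by (intro small_y_add bounded_small_mult[OF small_y_bounded[OF inverse_y_par_small]])
       (simp_all add: const_small const_intros w)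
  finally show "cf (inverse y_par *\<^sub>K R (gn (E 0)) w) p p' \<in> small_y" .
qed

context
  assumes vacuum: "Poly_Mapping.single Omega 1 \<in> S"
begin

lemma vac_states: "vac k \<in> states n"
  by (rule level_states[OF vac_level])

lemma kets_state: "p \<in> states n \<Longrightarrow> p' \<in> states n \<Longrightarrow> kets p p' = Poly_Mapping.single (p, p') 1"
  by (simp add: ket_state)

text \<open>The operators \<open>e\<^sub>j\<close> do not see the first factor, where no fermion can be moved.\<close>

lemma approx_second_factor:
  assumes "p' \<in> level m"
  shows "kets (vac l) p' \<in> approx"
  using assms
proof (induction p' rule: level_induct_ascending)
  case vac
  have "Poly_Mapping.single Omega 1 = kets (vac l) (vac m)" by (simp add: ket_state vac_states)
  then show ?case using vacuum by (intro approxI[OF _ kets_supported]) auto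
next
  case (create p)
  let ?r = "move n 1 p"
  have st: "p \<in> states n" using create.hyps(1) by (rule level_states)
  \<comment> \<open>The part of the image in which the particle is moved in the first factor; it is small.\<close>
  let ?e = "(inverse y_par * (x_par * qnum (int l) * k_eigenvalue 0 p)) *\<^sub>K kets (move n 1 (vac l)) p"
  have "inverse y_par *\<^sub>K R (gn (E 0)) (kets (vac l) p) = qnum (p n) *\<^sub>K kets (vac l) ?r + ?e"
    using y_par_nonzero st vac_states n2
    by (simp add: rho_ket op_E tens_linear source_eq target_eq pm.scale_right_distrib mult_ac)
       (simp add: vac_def)
  with approx_E0[OF create.IH] have *: "qnum (p n) *\<^sub>K kets (vac l) ?r + ?e \<in> approx" by simp
  have small: "inverse y_par * (x_par * qnum (int l) * k_eigenvalue 0 p) \<in> small_y"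
    by (subst mult.commute) (intro bounded_small_mult consts_y_bounded const_intros inverse_y_par_small)
  have kets_bounded: "cf (kets q q') r r' \<in> bounded_y" for q q' r r'
    by (auto simp: lookup_tens ket_def lookup_single when_def zero_bounded consts_y_bounded)
  have "cf ?e r r' \<in> small_y" for r r'
    unfolding lookup_smul by (subst mult.commute) (rule bounded_small_mult[OF kets_bounded small])
  then have "qnum (p n) *\<^sub>K kets (vac l) ?r \<in> approx"
    by (intro approx_perturb[OF *] pm.subspace_scale subspace_supported kets_supported) (simp add: lookup_add)
  then show ?case
    by (rule approx_unscale[OF _ qnum_consts]) (use create.hyps(2) in \<open>simp add: qnum_nonzero\<close>)
next
  case (shift p j)
  have "R (gn (E j)) (kets (vac l) p) = kets (vac l) (move j (Suc j) p)"
    using shift level_states[OF shift.hyps(1)] vac_states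
    by (simp add: rho_ket op_E tens_linear source_eq target_eq) (simp add: vac_def)
  then show ?case using approx_E[OF shift.IH shift.hyps(2)] shift by simp
qed

text \<open>The summand of \<open>f\<^sub>j\<close> acting on the second factor stays among the vectors with unchanged first factor,
  which are approximated by induction; hence the induction must cover all second factors at once.\<close>

lemma approx_kets:
  assumes "p \<in> level l" "p' \<in> level m"
  shows "kets p p' \<in> approx"
  using assms
proof (induction p arbitrary: p' rule: level_induct_descending)
  case vac
  then show ?case by (rule approx_second_factor)
next
  case (shift p j)
  note st = level_states[OF shift.hyps(1)] level_states[OF shift.prems]
  let ?e = "(inverse (k_eigenvalue j p) * qnum (p' (Suc j))) *\<^sub>K kets p (move (Suc j) j p')"
  have "R (gn (F j)) (kets p p') = qnum (p (Suc j)) *\<^sub>K kets (move (Suc j) j p) p' + ?e"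
    using shift st by (simp add: rho_ket op_F tens_linear source_eq target_eq)
  moreover have "R (gn (F j)) (kets p p') \<in> approx" using shift by (intro approx_F) auto
  moreover have "?e \<in> approx"
  proof (cases "move (Suc j) j p' \<in> states n")
    case True
    then have "move (Suc j) j p' \<in> level m"
      using shift st by (subst move_level_iff) auto
    then show ?thesis using shift by (intro approx_scale const_intros) auto
  next
    case False
    then have "?e = 0" by (simp add: ket_def)
    then show ?thesis using pm.subspace_0[OF subspace_S]
      by (auto intro!: approxI[of 0] simp: pm.subspace_0[OF subspace_supported])
  qed
  ultimately have "qnum (p (Suc j)) *\<^sub>K kets (move (Suc j) j p) p' \<in> approx"
    using approx_diff by (metis add_diff_cancel_right')
  then show ?case
    by (rule approx_unscale[OF _ qnum_consts]) (use shift.hyps(5) in \<open>simp add: qnum_nonzero\<close>)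
qed

lemma vacuum_generates: "supported (level l \<times> level m) \<subseteq> S"
proof (rule supported_subset_of_approximate_basis[OF _ subspace_S])
  show "finite (level l \<times> level m)" by (intro finite_cartesian_product finite_level)
  fix b assume "b \<in> level l \<times> level m"
  then obtain p p' where b: "b = (p, p')" "p \<in> level l" "p' \<in> level m" by auto
  then obtain s where s: "s \<in> S" "\<And>r r'. cf s r r' - cf (kets p p') r r' \<in> small_y"
    using approx_kets unfolding approx_def by blast
  have "cf (kets p p') r r' = (1 when (r, r') = b)" for r r'
    using b level_states by (simp add: kets_state lookup_single) (auto simp: when_def)
  then have "\<forall>c. Poly_Mapping.lookup s c - (1 when c = b) \<in> small_y"
    using s(2) by (metis surj_pair)
  then show "\<exists>s\<in>S \<inter> supported (level l \<times> level m).
      \<forall>c. Poly_Mapping.lookup s c - (1 when c = b) \<in> small_y"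
    using s(1) S_level by blast
qed

end

end

theorem proposition6p7:
  fixes n l m :: nat and \<epsilon> :: "nat \<Rightarrow> nat"
  assumes "n \<ge> 2"
    and "\<And>i. i \<in> {1..<n} \<Longrightarrow> \<epsilon> i = 1"
    and "\<epsilon> n = 0"
  shows "UA_irreducible n \<epsilon> (W_tensor n l m) (UA_tensor_action n \<epsilon> x_par y_par)"
proof -
  interpret UA_tensor n \<epsilon> x_par y_par
    by unfold_locales (use assms x_par_nonzero y_par_nonzero in auto)
  have "Poly_Mapping.single (vac l, vac m) (1 :: kfield) \<in> W_tensor n l m"
    by (simp add: W_tensor_eq single_in_supported vac_level)
  moreover have "Poly_Mapping.single (vac l, vac m) (1 :: kfield) \<noteq> 0"
    by (metis lookup_single_eq lookup_zero zero_neq_one)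
  moreover have "S = {0} \<or> S = W_tensor n l m"
    if S: "S \<subseteq> W_tensor n l m" "UA_module n \<epsilon> S (UA_tensor_action n \<epsilon> x_par y_par)" for S
  proof -
    have "pm.subspace S" and closed: "\<And>a v. a \<in> carrier (free_algebra n) \<Longrightarrow> v \<in> S \<Longrightarrow> R a v \<in> S"
      using S UA_module_iff W_tensor_supported by (meson subset_trans)+
    then interpret UA_submodule n \<epsilon> l m S
      using S(1) by unfold_locales (auto simp: W_tensor_eq gn_in_free_algebra intro!: closed)
    show ?thesis
      using vacuum_in_submodule vacuum_generates S(1) by (auto simp: W_tensor_eq)
  qed
  ultimately show ?thesis
    using UA_module_W_tensor by (auto simp: UA_irreducible_def)
qed

end
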